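(* Let $m_1,m_2,m_3\in\mathbb N$ and $m=m_1+m_2+m_3$. Let $\mathcal T_{2,6}$ be the set of partitions $\pi$ of $[m]$ such that $T^\pi_{m_1,m_2,m_3}$ is of $2$-$6$ tree type. Then $$|\mathcal T_{2,6}|=4\,|\mathcal{PS}^{(1,1,1)}_{NC_2}(m_1,m_2,m_3)|.$$
   Context: $\gamma=\gamma_{m_1,m_2,m_3}$ is the permutation of $[m]$ with three cycles, the $j$-th being $[\![m_j]\!]=(m_1+\cdots+m_{j-1}+1,\dots,m_1+\cdots+m_j)$. $T_{m_1,m_2,m_3}$ is the oriented graph with vertex set $[m]$ and edges $e_1,\dots,e_m$, $e_i$ going from $\gamma(i)$ to $i$; it is the disjoint union of basic cycles $T_{m_1},T_{m_2},T_{m_3}$. For a partition $\pi$ of $[m]$, the quotient graph $T^\pi_{m_1,m_2,m_3}$ has the blocks of $\pi$ as vertices and edges $e_1,\dots,e_m$, $e_i$ going from the block of $\gamma(i)$ to the block of $i$; $T^\pi_{m_j}$ is the quotient of $T_{m_j}$ by the restriction of $\pi$ to $[\![m_j]\!]$. Two edges are equivalent if they join the same unordered pair of vertices; the elementarization (denoted by an overline) is the unoriented graph on the same vertices whose edges are the equivalence classes; multiplicity is the cardinality of the class. $T^\pi_{m_j}$ is a double tree if $\overline{T^\pi_{m_j}}$ is a tree and every edge has multiplicity 2 and consists of two edges with opposite orientations. $T^\pi_{m_1,m_2,m_3}$ is of $2$-$6$ tree type if $T^\pi_{m_1},T^\pi_{m_2},T^\pi_{m_3}$ are double trees and $T^\pi_{m_1,m_2,m_3}$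 is obtained by joining them along one and the same edge (an edge of each tree is chosen and the three are glued together to an edge of multiplicity 6 in $\overline{T^\pi_{m_1,m_2,m_3}}$, with no other vertex identifications between the three trees). $NC_2(m_i)$ is the set of non-crossing pairings of the cyclically ordered set $[\![m_i]\!]$, regarded as permutations. $\mathcal{PS}^{(1,1,1)}_{NC_2}(m_1,m_2,m_3)$ is the set of pairs $(\mathcal V,\pi)$ with $\pi=\pi_1\times\pi_2\times\pi_3\in S_m$, $\pi_i\in NC_2(m_i)$, and $\mathcal V$ a partition of $[m]$ each of whose blocks is a cycle of $\pi$, except one block which is the union of three cycles of $\pi$, one from each $\pi_i$. *)

theory Defs
  imports
    "HOL-Library.Disjoint_Sets"
    "HOL-Combinatorics.Cycles"
    "HOL-Combinatorics.Orbits"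
    "Graph_Theory.Digraph"
begin

section \<open>Unoriented graphs and elementarization\<close>

text \<open>Oriented multigraphs are the pre-digraphs of \<open>Graph_Theory\<close>. Unoriented graphs carry an
  abstract edge type; an edge \<open>e\<close> joins the vertices in \<open>uends G e\<close>, which is a singleton
  when \<open>e\<close> is a loop.\<close>

record ('v, 'e) ugraph =
  uverts :: "'v set"
  uedges :: "'e set"
  uends :: "'e \<Rightarrow> 'v set"

definition uconnected :: "('v, 'e) ugraph \<Rightarrow> bool" where
  "uconnected G \<longleftrightarrow> uverts G \<noteq> {} \<and>
     (\<forall>u \<in> uverts G. \<forall>v \<in> uverts G. (u, v) \<in> {(x, y). \<exists>e \<in> uedges G. uends G e = {x, y}}\<^sup>*)"

text \<open>A cycle is given by its distinct vertices and distinct edges in cyclic order. Loops are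
  cycles of length 1 and pairs of parallel edges are cycles of length 2.\<close>

definition ucycle :: "('v, 'e) ugraph \<Rightarrow> 'v list \<Rightarrow> 'e list \<Rightarrow> bool" where
  "ucycle G vs es \<longleftrightarrow>
     vs \<noteq> [] \<and> length es = length vs \<and> distinct vs \<and> distinct es \<and>
     set vs \<subseteq> uverts G \<and> set es \<subseteq> uedges G \<and>
     (\<forall>i < length vs. uends G (es ! i) = {vs ! i, vs ! (Suc i mod length vs)})"

definition utree :: "('v, 'e) ugraph \<Rightarrow> bool" where
  "utree G \<longleftrightarrow> uconnected G \<and> (\<nexists>vs es. ucycle G vs es)"

definition edge_equiv :: "('v, 'e) pre_digraph \<Rightarrow> ('e \<times> 'e) set" where
  "edge_equiv G = {(e, f). e \<in> arcs G \<and> f \<in> arcs G \<and>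
     {tail G e, head G e} = {tail G f, head G f}}"

text \<open>The edges of the elementarization are equivalence classes of arcs, so the multiplicity of
  an edge \<open>C\<close> is \<open>card C\<close>.\<close>

definition elementarization :: "('v, 'e) pre_digraph \<Rightarrow> ('v, 'e set) ugraph" where
  "elementarization G =
     \<lparr> uverts = verts G,
       uedges = arcs G // edge_equiv G,
       uends = (\<lambda>C. \<Union>e \<in> C. {tail G e, head G e}) \<rparr>"

definition double_tree :: "('v, 'e) pre_digraph \<Rightarrow> bool" where
  "double_tree G \<longleftrightarrow> utree (elementarization G) \<and>
     (\<forall>C \<in> uedges (elementarization G).
        \<exists>e f. e \<noteq> f \<and> C = {e, f} \<and> tail G e = head G f \<and> head G e = tail G f)"


section \<open>Quotients of the union of cycles\<close>

text \<open>\<open>seg ms j\<close> is the \<open>j\<close>-th interval, counting from 0, in its cyclic order; so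
  \<open>[m1, m2, m3]\<close> yields \<open>[1..m1]\<close>, \<open>[m1 + 1..m1 + m2]\<close>, \<open>[m1 + m2 + 1..m1 + m2 + m3]\<close>.\<close>

definition seg :: "nat list \<Rightarrow> nat \<Rightarrow> nat list" where
  "seg ms j = [sum_list (take j ms) + 1 ..< sum_list (take (Suc j) ms) + 1]"

definition gamma :: "nat \<Rightarrow> nat \<Rightarrow> nat \<Rightarrow> nat \<Rightarrow> nat" where
  "gamma m1 m2 m3 =
     cycle_of_list (seg [m1, m2, m3] 0) \<circ>
     cycle_of_list (seg [m1, m2, m3] 1) \<circ>
     cycle_of_list (seg [m1, m2, m3] 2)"

text \<open>The arc \<open>e\<^sub>i\<close> is represented by its index \<open>i\<close>.\<close>

definition perm_graph :: "nat set \<Rightarrow> (nat \<Rightarrow> nat) \<Rightarrow> (nat, nat) pre_digraph" where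
  "perm_graph A g = \<lparr> verts = A, arcs = A, tail = g, head = id \<rparr>"

definition T_graph :: "nat \<Rightarrow> nat \<Rightarrow> nat \<Rightarrow> (nat, nat) pre_digraph" where
  "T_graph m1 m2 m3 = perm_graph {1..m1 + m2 + m3} (gamma m1 m2 m3)"

definition T_comp :: "nat \<Rightarrow> nat \<Rightarrow> nat \<Rightarrow> nat \<Rightarrow> (nat, nat) pre_digraph" where
  "T_comp m1 m2 m3 j = perm_graph (set (seg [m1, m2, m3] j)) (gamma m1 m2 m3)"

definition block_of :: "'a set set \<Rightarrow> 'a \<Rightarrow> 'a set" where
  "block_of P x = (THE B. B \<in> P \<and> x \<in> B)"

definition restrict_partition :: "'a set set \<Rightarrow> 'a set \<Rightarrow> 'a set set" where
  "restrict_partition P A = {B \<inter> A | B. B \<in> P} - {{}}"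

definition quotient_graph :: "('a, 'e) pre_digraph \<Rightarrow> 'a set set \<Rightarrow> ('a set, 'e) pre_digraph" where
  "quotient_graph G P =
     \<lparr> verts = P, arcs = arcs G, tail = block_of P \<circ> tail G, head = block_of P \<circ> head G \<rparr>"

abbreviation T_quot :: "nat \<Rightarrow> nat \<Rightarrow> nat \<Rightarrow> nat set set \<Rightarrow> (nat set, nat) pre_digraph" where
  "T_quot m1 m2 m3 P \<equiv> quotient_graph (T_graph m1 m2 m3) P"

abbreviation T_comp_quot ::
  "nat \<Rightarrow> nat \<Rightarrow> nat \<Rightarrow> nat \<Rightarrow> nat set set \<Rightarrow> (nat set, nat) pre_digraph" where
  "T_comp_quot m1 m2 m3 j P \<equiv>
     quotient_graph (T_comp m1 m2 m3 j) (restrict_partition P (set (seg [m1, m2, m3] j)))"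

text \<open>The edge \<open>C\<close> below is the common edge: its arcs in the \<open>j\<close>-th cycle form the edge chosen
  in the \<open>j\<close>-th tree. A vertex of the \<open>j\<close>-th tree is the trace on the \<open>j\<close>-th interval of a
  block \<open>B\<close>, so vertices of different trees are identified exactly when \<open>B\<close> meets several
  intervals; this is only allowed for the endpoints of \<open>C\<close>.\<close>

definition two_six_tree_type :: "nat \<Rightarrow> nat \<Rightarrow> nat \<Rightarrow> nat set set \<Rightarrow> bool" where
  "two_six_tree_type m1 m2 m3 P \<longleftrightarrow>
     (\<forall>j < 3. double_tree (T_comp_quot m1 m2 m3 j P)) \<and>
     (\<exists>C \<in> uedges (elementarization (T_quot m1 m2 m3 P)).
        card C = 6 \<and>
        (\<forall>j < 3. C \<inter> set (seg [m1, m2, m3] j)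
                   \<in> uedges (elementarization (T_comp_quot m1 m2 m3 j P))) \<and>
        (\<forall>B \<in> verts (T_quot m1 m2 m3 P) - uends (elementarization (T_quot m1 m2 m3 P)) C.
           \<exists>j < 3. B \<subseteq> set (seg [m1, m2, m3] j)))"

definition T26 :: "nat \<Rightarrow> nat \<Rightarrow> nat \<Rightarrow> nat set set set" where
  "T26 m1 m2 m3 = {P. partition_on {1..m1 + m2 + m3} P \<and> two_six_tree_type m1 m2 m3 P}"


section \<open>Partitioned permutations\<close>

text \<open>Pairings are regarded as fixed-point-free involutions. Being non-crossing with respect to
  the linear order or to the induced cyclic order is the same thing.\<close>

definition NC2 :: "nat set \<Rightarrow> (nat \<Rightarrow> nat) set" where
  "NC2 A = {p. p permutes A \<and> (\<forall>x \<in> A. p x \<noteq> x \<and> p (p x) = x) \<and>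
     \<not> (\<exists>a \<in> A. \<exists>b \<in> A. \<exists>c \<in> A. \<exists>d \<in> A. a < b \<and> b < c \<and> c < d \<and> p a = c \<and> p b = d)}"

definition perm_cycles :: "(nat \<Rightarrow> nat) \<Rightarrow> nat set \<Rightarrow> nat set set" where
  "perm_cycles p A = orbit p ` A"

definition PS_NC2_111 :: "nat \<Rightarrow> nat \<Rightarrow> nat \<Rightarrow> (nat set set \<times> (nat \<Rightarrow> nat)) set" where
  "PS_NC2_111 m1 m2 m3 =
     (let A1 = set (seg [m1, m2, m3] 0);
          A2 = set (seg [m1, m2, m3] 1);
          A3 = set (seg [m1, m2, m3] 2);
          M = {1..m1 + m2 + m3}
      in {(V, p). \<exists>p1 \<in> NC2 A1. \<exists>p2 \<in> NC2 A2. \<exists>p3 \<in> NC2 A3.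
            p = p1 \<circ> p2 \<circ> p3 \<and> partition_on M V \<and>
            (\<exists>c1 \<in> perm_cycles p1 A1. \<exists>c2 \<in> perm_cycles p2 A2. \<exists>c3 \<in> perm_cycles p3 A3.
               c1 \<union> c2 \<union> c3 \<in> V \<and> (\<forall>B \<in> V - {c1 \<union> c2 \<union> c3}. B \<in> perm_cycles p M))})"

end

theory Submission
  imports Defs
begin

text \<open>A connected graph is a tree iff every edge is a cut. In the quotient of a cycle this makes the
  double trees exactly the quotients by the Kreweras complements of the non-crossing pairings \<open>p\<close>:
  the edges of the tree are the pairs \<open>{a, p a}\<close>, the non-crossing condition says that the interval
  from \<open>a\<close> (exclusive) to \<open>p a > a\<close> (inclusive) is a union of blocks, and this interval is one side of the cut.

  Both sides of the identity are then counted through the set \<open>D\<close> of all choices of three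
  pairings together with one arc \<open>d j\<close> in each cycle. Glueing the heads of the chosen arcs and
  glueing their tails yields a partition of 2-6 tree type, and two choices give the same partition
  iff they are equal or differ by replacing all three arcs by their partners. Uniting the
  three pairs of the chosen arcs yields a partitioned permutation, and here each of the three arcs
  may be replaced by its partner. Hence \<open>2 |T26| = |D| = 8 |PS|\<close>.\<close>

section \<open>Cuts in graphs\<close>

text \<open>Cuts become manageable because a cut of a quotient of a cycle pulls back to a set of
  points whose membership changes exactly at the arcs of one edge. In a double tree these are just
  two arcs \<open>a\<close> and \<open>p a\<close>, so the set is an interval or its complement.
  Acyclicity thus says that no block straddles such an interval; from this follow both the absence
  of crossings and the fact that no block is larger than a Kreweras class.

  Arcs \<open>d j\<close>, and not edges \<open>{d j, p (d j)}\<close>, are chosen because glueing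
  three edges needs an orientation of each. There are 2^3 = 8 orientations, and reversing all three
  gives the same glueing, whereas a partitioned permutation remembers the three edges only. This is
  the origin of 4 = 8 / 2.

  If some cycle has odd length or is empty, then \<open>D\<close> is empty and both sides vanish, so
  these sizes are covered by the same count.\<close>

text \<open>A loop has no cut set, since \<open>u = v\<close> is among the instances; so the
  existence of cuts excludes loops as well as longer cycles.\<close>

definition cut_set :: "('v, 'e) ugraph \<Rightarrow> 'e \<Rightarrow> 'v set \<Rightarrow> bool" where
  "cut_set G e X \<longleftrightarrow>
     (\<forall>u v. uends G e = {u, v} \<longrightarrow> (u \<in> X \<longleftrightarrow> v \<notin> X)) \<and>
     (\<forall>f \<in> uedges G - {e}. \<forall>u v. uends G f = {u, v} \<longrightarrow> (u \<in> X \<longleftrightarrow> v \<in> X))"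

text \<open>Once around a cycle the side would change exactly once, at the edge that
  \<open>X\<close> cuts, which is impossible for a closed walk.\<close>

lemma no_ucycle_if_cut_sets:
  assumes "\<And>e. e \<in> uedges G \<Longrightarrow> \<exists>X. cut_set G e X"
  shows "\<not> ucycle G vs es"
proof
  assume C: "ucycle G vs es"
  define n where "n = length vs"
  have n: "n > 0" "length es = n" "distinct es" "set es \<subseteq> uedges G"
    and ends: "\<And>i. i < n \<Longrightarrow> uends G (es ! i) = {vs ! i, vs ! (Suc i mod n)}"
    using C by (auto simp: ucycle_def n_def)
  have in_edges: "es ! i \<in> uedges G" if "i < n" for i
    using n that by (metis nth_mem subsetD)
  obtain X where X: "cut_set G (es ! 0) X" using assms in_edges n(1) by blast
  \<comment> \<open>The side is constant from vertex 1 up to vertex \<open>n\<close>, which is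
    vertex 0 again. Writing \<open>1 mod n\<close> covers loops, where \<open>n = 1\<close>.\<close>
  have step: "vs ! (k mod n) \<in> X \<longleftrightarrow> vs ! (1 mod n) \<in> X" if "1 \<le> k" "k \<le> n" for k
    using that
  proof (induction k rule: dec_induct)
    case (step k)
    have "es ! k \<noteq> es ! 0"
      using step n nth_eq_iff_index_eq[OF n(3), of k 0] by auto
    then have "vs ! k \<in> X \<longleftrightarrow> vs ! (Suc k mod n) \<in> X"
      using X ends[of k] in_edges[of k] step by (auto simp: cut_set_def)
    with step show ?case by simp
  qed simp
  from step[of n] n have "vs ! 0 \<in> X \<longleftrightarrow> vs ! (1 mod n) \<in> X" by simp
  moreover have "vs ! 0 \<in> X \<longleftrightarrow> vs ! (1 mod n) \<notin> X"
    using X ends[of 0] n(1) by (auto simp: cut_set_def)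
  ultimately show False by blast
qed

text \<open>A shortest path avoiding \<open>e\<close> between the endpoints of \<open>e\<close> has distinct vertices, so together
  with \<open>e\<close> it is a cycle.\<close>

lemma no_ucycle_bridge:
  assumes acyclic: "\<nexists>vs es. ucycle G vs es"
    and e: "e \<in> uedges G" "uends G e = {u, v}"
    and verts: "\<And>f. f \<in> uedges G \<Longrightarrow> uends G f \<subseteq> uverts G"
  shows "(u, v) \<notin> {(x, y). \<exists>f \<in> uedges G - {e}. uends G f = {x, y}}\<^sup>*"
proof
  let ?R = "{(x, y). \<exists>f \<in> uedges G - {e}. uends G f = {x, y}}"
  assume "(u, v) \<in> ?R\<^sup>*"
  then have ex: "\<exists>k. (u, v) \<in> ?R ^^ k" by (simp add: rtrancl_power)
  define k where "k = (LEAST k. (u, v) \<in> ?R ^^ k)"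
  have k: "(u, v) \<in> ?R ^^ k" unfolding k_def using ex by (rule LeastI_ex)
  have k_min: "k \<le> l" if "(u, v) \<in> ?R ^^ l" for l
    unfolding k_def using that by (rule Least_le)
  from k obtain w where w: "w 0 = u" "w k = v" "\<And>i. i < k \<Longrightarrow> (w i, w (Suc i)) \<in> ?R"
    unfolding relpow_fun_conv by blast
  have "w i \<noteq> w j" if "i < j" "j \<le> k" for i j
  proof
    assume eq: "w i = w j"
    have "(u, w i) \<in> ?R ^^ i"
      unfolding relpow_fun_conv using w that by (intro exI[of _ w]) auto
    moreover have "(w j, v) \<in> ?R ^^ (k - j)"
      unfolding relpow_fun_conv using w that by (intro exI[of _ "\<lambda>l. w (j + l)"]) auto
    ultimately have "(u, v) \<in> ?R ^^ (i + (k - j))"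
      unfolding relpow_add using eq by auto
    from k_min[OF this] that show False by simp
  qed
  then have inj: "inj_on w {..k}"
    by (intro linorder_inj_onI) auto
  have "\<forall>i. \<exists>f. i < k \<longrightarrow> f \<in> uedges G - {e} \<and> uends G f = {w i, w (Suc i)}"
    using w(3) by blast
  then obtain h where h: "\<And>i. i < k \<Longrightarrow> h i \<in> uedges G - {e} \<and> uends G (h i) = {w i, w (Suc i)}"
    by metis
  have inj_h: "inj_on h {..<k}"
  proof (rule inj_onI)
    fix i j assume ij: "i \<in> {..<k}" "j \<in> {..<k}" "h i = h j"
    then have "{w i, w (Suc i)} = {w j, w (Suc j)}" using h by (metis lessThan_iff)
    \<comment> \<open>By injectivity of \<open>w\<close> the second alternative would force both
      \<open>i = Suc j\<close> and \<open>Suc i = j\<close>.\<close>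
    then have "w i = w j \<or> (w i = w (Suc j) \<and> w (Suc i) = w j)"
      by (auto simp: doubleton_eq_iff)
    then show "i = j" using inj ij
      by (metis (no_types, opaque_lifting) atMost_iff inj_on_eq_iff lessThan_iff less_imp_le
          Suc_leI n_not_Suc_n Suc_n_not_le_n nat_le_linear not_less_eq_eq order_refl)
  qed
  define vs where "vs = map w [0..<Suc k]"
  define es where "es = map h [0..<k] @ [e]"
  \<comment> \<open>The last edge \<open>e\<close> closes the path from \<open>w k = v\<close> back
    to \<open>w 0 = u\<close>; for \<open>k = 0\<close> it is a loop.\<close>
  have ends: "uends G (es ! i) = {vs ! i, vs ! (Suc i mod length vs)}" if "i < Suc k" for i
  proof (cases "i < k")
    case True
    then show ?thesis using h by (simp add: es_def vs_def nth_append del: upt_Suc)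
  next
    case False
    then have "i = k" using that by simp
    then show ?thesis using e w by (simp add: es_def vs_def nth_append insert_commute del: upt_Suc)
  qed
  have es: "set es \<subseteq> uedges G" using h e by (auto simp: es_def)
  have "ucycle G vs es"
    unfolding ucycle_def
  proof (intro conjI allI impI)
    show "distinct vs" using inj
      by (auto simp: vs_def distinct_map atLeast0LessThan lessThan_Suc_atMost simp del: upt_Suc)
    show "distinct es" using inj_h h by (auto simp: es_def distinct_map atLeast0LessThan)
    show "set vs \<subseteq> uverts G"
    proof
      fix x assume "x \<in> set vs"
      then obtain i where i: "i < Suc k" "x = vs ! i"
        by (auto simp: in_set_conv_nth vs_def simp del: upt_Suc)
      have "length es = Suc k" by (simp add: es_def)
      then have "es ! i \<in> uedges G" using es i nth_mem by (metis subsetD)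
      then show "x \<in> uverts G" using verts ends i by blast
    qed
  qed (use es ends in \<open>auto simp: vs_def es_def\<close>)
  with acyclic show False by blast
qed

text \<open>The side is the component of \<open>u\<close> after deletion of \<open>e\<close>; it
  misses \<open>v\<close> because \<open>e\<close> is a bridge.\<close>

lemma no_ucycle_obtains_cut_set:
  assumes "\<nexists>vs es. ucycle G vs es" "e \<in> uedges G" "uends G e = {u, v}"
    and "\<And>f. f \<in> uedges G \<Longrightarrow> uends G f \<subseteq> uverts G"
  obtains X where "cut_set G e X"
proof -
  let ?R = "{(x, y). \<exists>f \<in> uedges G - {e}. uends G f = {x, y}}"
  define X where "X = ?R\<^sup>* `` {u}"
  have "u \<in> X" "v \<notin> X" using no_ucycle_bridge[OF assms] by (auto simp: X_def)
  moreover have "x \<in> X \<longleftrightarrow> y \<in> X" if "f \<in> uedges G - {e}" "uends G f = {x, y}" for f x y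
  proof -
    have "(x, y) \<in> ?R" "(y, x) \<in> ?R" using that by (auto simp: insert_commute)
    then show ?thesis unfolding X_def by (meson Image_singleton_iff rtrancl.rtrancl_into_rtrancl)
  qed
  ultimately have "cut_set G e X"
    using assms(3) unfolding cut_set_def by (auto simp: doubleton_eq_iff)
  then show thesis by (rule that)
qed

section \<open>Quotients of a cycle\<close>

lemma block_of_eq:
  assumes "partition_on A Q" "B \<in> Q" "x \<in> B"
  shows "block_of Q x = B"
  unfolding block_of_def
  using assms by (intro the_equality) (auto simp: partition_on_def disjoint_def)

lemma block_of_mem:
  assumes "partition_on A Q" "x \<in> A"
  shows "block_of Q x \<in> Q" "x \<in> block_of Q x"
proof -
  obtain B where "B \<in> Q" "x \<in> B" using assms by (auto simp: partition_on_def)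
  then show "block_of Q x \<in> Q" "x \<in> block_of Q x" using block_of_eq[OF assms(1)] by auto
qed

lemma block_of_image_eq:
  assumes "partition_on A Q"
  shows "block_of Q ` A = Q"
proof
  show "block_of Q ` A \<subseteq> Q" using block_of_mem[OF assms] by blast
  show "Q \<subseteq> block_of Q ` A"
  proof
    fix B assume B: "B \<in> Q"
    then have "B \<noteq> {}" "B \<subseteq> A" using assms by (auto simp: partition_on_def)
    then obtain x where "x \<in> B" "x \<in> A" by blast
    then show "B \<in> block_of Q ` A" using block_of_eq[OF assms B] by blast
  qed
qed

section \<open>Edges and cuts of a quotient in terms of arcs\<close>

definition arc_ends :: "(nat \<Rightarrow> nat) \<Rightarrow> nat set set \<Rightarrow> nat \<Rightarrow> nat set set" where
  "arc_ends g Q e = {block_of Q (g e), block_of Q e}"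

text \<open>This is the edge of the elementarization that contains the arc \<open>e\<close>.\<close>

definition arc_class :: "nat set \<Rightarrow> (nat \<Rightarrow> nat) \<Rightarrow> nat set set \<Rightarrow> nat \<Rightarrow> nat set" where
  "arc_class A g Q e = {f \<in> A. arc_ends g Q f = arc_ends g Q e}"

abbreviation quot :: "nat set \<Rightarrow> (nat \<Rightarrow> nat) \<Rightarrow> nat set set \<Rightarrow> (nat set, nat) pre_digraph" where
  "quot A g Q \<equiv> quotient_graph (perm_graph A g) Q"

lemma arc_class_self: "e \<in> A \<Longrightarrow> e \<in> arc_class A g Q e"
  by (simp add: arc_class_def)

lemma uverts_quot: "uverts (elementarization (quot A g Q)) = Q"
  by (simp add: elementarization_def quotient_graph_def)

lemma uedges_quot: "uedges (elementarization (quot A g Q)) = arc_class A g Q ` A"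
  unfolding elementarization_def quotient_graph_def perm_graph_def edge_equiv_def quotient_def
    arc_class_def arc_ends_def
  by auto

lemma uends_quot:
  assumes "e \<in> A"
  shows "uends (elementarization (quot A g Q)) (arc_class A g Q e) = arc_ends g Q e"
proof -
  have "uends (elementarization (quot A g Q)) (arc_class A g Q e) =
      (\<Union>f \<in> arc_class A g Q e. arc_ends g Q f)"
    by (simp add: elementarization_def quotient_graph_def perm_graph_def arc_ends_def)
  also have "\<dots> = arc_ends g Q e" using assms by (auto simp: arc_class_def)
  finally show ?thesis .
qed

text \<open>This moves a cut from the quotient graph to the cycle: on a walk along \<open>g\<close>,
  the side changes exactly at the arcs of the class.\<close>

lemma cut_set_quot_iff:
  assumes "e \<in> A"
  shows "cut_set (elementarization (quot A g Q)) (arc_class A g Q e) X \<longleftrightarrow>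
    (\<forall>f \<in> A. (block_of Q f \<in> X \<longleftrightarrow> block_of Q (g f) \<in> X) \<longleftrightarrow> f \<notin> arc_class A g Q e)"
    (is "?L \<longleftrightarrow> ?R")
proof
  assume L: ?L
  show ?R
  proof
    fix f assume f: "f \<in> A"
    show "(block_of Q f \<in> X \<longleftrightarrow> block_of Q (g f) \<in> X) \<longleftrightarrow> f \<notin> arc_class A g Q e"
    proof (cases "f \<in> arc_class A g Q e")
      case True
      then have "arc_class A g Q f = arc_class A g Q e" by (auto simp: arc_class_def)
      then show ?thesis using L True uends_quot[OF f, of g Q]
        unfolding cut_set_def arc_ends_def by auto
    next
      case False
      then have "arc_class A g Q f \<noteq> arc_class A g Q e" using arc_class_self[OF f] by blast
      then have "arc_class A g Q f \<in> uedges (elementarization (quot A g Q)) - {arc_class A g Q e}"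
        using f by (simp add: uedges_quot)
      then have "block_of Q (g f) \<in> X \<longleftrightarrow> block_of Q f \<in> X"
        using L uends_quot[OF f, of g Q] unfolding cut_set_def arc_ends_def by blast
      then show ?thesis using False by blast
    qed
  qed
next
  assume R: ?R
  show ?L
    unfolding cut_set_def uedges_quot
  proof (intro conjI ballI allI impI)
    fix u v
    assume "uends (elementarization (quot A g Q)) (arc_class A g Q e) = {u, v}"
    then show "u \<in> X \<longleftrightarrow> v \<notin> X"
      using R assms arc_class_self[OF assms, of g Q] 
      by (auto simp: uends_quot[OF assms] arc_ends_def doubleton_eq_iff)
  next
    fix C u v
    assume C: "C \<in> arc_class A g Q ` A - {arc_class A g Q e}"
      and uv: "uends (elementarization (quot A g Q)) C = {u, v}"
    then obtain f where f: "f \<in> A" "C = arc_class A g Q f" by auto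
    with C have "f \<notin> arc_class A g Q e" by (auto simp: arc_class_def)
    then show "u \<in> X \<longleftrightarrow> v \<in> X"
      using R f uv by (auto simp: uends_quot arc_ends_def doubleton_eq_iff)
  qed
qed

section \<open>A single cycle on an interval\<close>

text \<open>Nothing is said about \<open>g\<close> outside the interval, so the same
  \<open>gamma\<close> can serve for each of its three cycles.\<close>

locale interval_cycle =
  fixes lo hi :: nat and g :: "nat \<Rightarrow> nat"
  assumes g_step: "\<And>i. lo \<le> i \<Longrightarrow> Suc i < hi \<Longrightarrow> g i = Suc i"
    and g_wrap: "\<And>i. lo \<le> i \<Longrightarrow> Suc i = hi \<Longrightarrow> g i = lo"
begin

abbreviation A :: "nat set" where "A \<equiv> {lo..<hi}"

lemma g_cases:
  assumes "x \<in> A"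
  obtains "Suc x < hi" "g x = Suc x" | "Suc x = hi" "g x = lo"
proof (cases "Suc x < hi")
  case True
  then show ?thesis using that(1) g_step assms by simp
next
  case False
  then show ?thesis using that(2) g_wrap assms by simp
qed

lemma g_mem: "x \<in> A \<Longrightarrow> g x \<in> A"
  using g_cases[of x] by (metis atLeastLessThan_iff le_SucI less_Suc_eq_le order_refl order_trans)

lemma uconnected_quot:
  assumes Q: "partition_on A Q" and ne: "A \<noteq> {}"
  shows "uconnected (elementarization (quot A g Q))"
proof -
  let ?G = "elementarization (quot A g Q)"
  let ?R = "{(x, y). \<exists>e \<in> uedges ?G. uends ?G e = {x, y}}"
  have sym: "sym (?R\<^sup>*)" by (intro sym_rtrancl symI) (auto simp: insert_commute)
  have lo: "(block_of Q lo, block_of Q x) \<in> ?R\<^sup>*" if "lo \<le> x" "x < hi" for x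
    using that
  proof (induction x rule: dec_induct)
    case (step n)
    have n: "n \<in> A" "g n = Suc n" using step g_step by auto
    then have "uends ?G (arc_class A g Q n) = {block_of Q n, block_of Q (Suc n)}"
      using uends_quot[OF n(1), of g Q] by (auto simp: arc_ends_def)
    moreover have "arc_class A g Q n \<in> uedges ?G" using n(1) unfolding uedges_quot by (rule imageI)
    ultimately have "(block_of Q n, block_of Q (Suc n)) \<in> ?R" by blast
    with step show ?case by (auto intro: rtrancl_into_rtrancl)
  qed auto
  have block: "\<exists>x. lo \<le> x \<and> x < hi \<and> B = block_of Q x" if "B \<in> Q" for B
  proof -
    have "B \<in> block_of Q ` A" using that block_of_image_eq[OF Q] by simp
    then show ?thesis by auto
  qed
  have "(B, B') \<in> ?R\<^sup>*" if "B \<in> Q" "B' \<in> Q" for B B'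
    using block[OF that(1)] block[OF that(2)] lo symD[OF sym] by (metis (lifting) rtrancl_trans)
  moreover have "Q \<noteq> {}" using ne Q by (auto simp: partition_on_def)
  ultimately show ?thesis unfolding uconnected_def uverts_quot by blast
qed

text \<open>The arc \<open>x\<close> joins \<open>x\<close> and \<open>g x\<close>. Deleting the
  arcs \<open>a\<close> and \<open>p a\<close> thus cuts the cycle just after each of these points,
  which is why the interval is open on the left and closed on the right.\<close>

definition arc_between :: "(nat \<Rightarrow> nat) \<Rightarrow> nat \<Rightarrow> nat set" where
  "arc_between p a = {min a (p a)<..max a (p a)}"

text \<open>A step leaves or enters the interval only at its two boundary arcs. The wrapping step
  fits in because \<open>lo\<close> never belongs to the interval.\<close>

lemma arc_between_step:
  assumes "a \<in> A" "p a \<in> A" "p a \<noteq> a" "x \<in> A"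
  shows "(x \<in> arc_between p a \<longleftrightarrow> g x \<in> arc_between p a) \<longleftrightarrow> x \<notin> {a, p a}"
  using \<open>x \<in> A\<close>
  by (rule g_cases) (use assms in \<open>auto simp: arc_between_def min_def max_def split: if_splits\<close>)

text \<open>Both sets change at the same arcs, so the set \<open>Y\<close> where they agree changes
  at none and contains all of the cycle or nothing of it. Hence \<open>X\<close> is the interval or
  its complement on \<open>A\<close>.\<close>

lemma constant_across_arc_between:
  fixes X :: "nat set"
  assumes a: "a \<in> A" "p a \<in> A" "p a \<noteq> a"
    and X: "\<And>x. x \<in> A \<Longrightarrow> (x \<in> X \<longleftrightarrow> g x \<in> X) \<longleftrightarrow> x \<notin> {a, p a}"
    and xy: "x \<in> A" "y \<in> A"
  shows "(x \<in> X \<longleftrightarrow> y \<in> X) \<longleftrightarrow> (x \<in> arc_between p a \<longleftrightarrow> y \<in> arc_between p a)"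
proof -
  define Y where "Y = {x. x \<in> X \<longleftrightarrow> x \<in> arc_between p a}"
  have Y: "lo \<in> Y \<longleftrightarrow> z \<in> Y" if "lo \<le> z" "z < hi" for z
    using that
  proof (induction z rule: dec_induct)
    case (step n)
    then have "n \<in> A" "g n = Suc n" using g_step by auto
    then show ?case using step X[of n] arc_between_step[of a p n, OF a] by (auto simp: Y_def)
  qed auto
  show ?thesis using Y[of x] Y[of y] xy by (auto simp: Y_def)
qed

section \<open>Non-crossing pairings and their Kreweras classes\<close>

text \<open>Unlike \<open>NC2\<close>, this constrains \<open>p\<close> on \<open>A\<close> only, so
  that one function can be a pairing of all three cycles at once.\<close>

definition nc_pairing :: "(nat \<Rightarrow> nat) \<Rightarrow> bool" where
  "nc_pairing p \<longleftrightarrow> (\<forall>x \<in> A. p x \<in> A \<and> p x \<noteq> x \<and> p (p x) = x) \<and>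
     \<not> (\<exists>a \<in> A. \<exists>b \<in> A. \<exists>c \<in> A. \<exists>d \<in> A. a < b \<and> b < c \<and> c < d \<and> p a = c \<and> p b = d)"

lemma nc_pairingD:
  assumes "nc_pairing p" "x \<in> A"
  shows "p x \<in> A" "p x \<noteq> x" "p (p x) = x"
  using assms by (auto simp: nc_pairing_def)

lemma nc_pairing_not_crossing:
  assumes "nc_pairing p" "a < b" "b < p a" "p a < p b" "a \<in> A" "b \<in> A"
  shows False
proof -
  have "p a \<in> A" "p b \<in> A" using nc_pairingD(1)[OF assms(1)] assms(5,6) by auto
  moreover have "\<not> (\<exists>a \<in> A. \<exists>b \<in> A. \<exists>c \<in> A. \<exists>d \<in> A. a < b \<and> b < c \<and> c < d \<and> p a = c \<and> p b = d)"
    using assms(1) unfolding nc_pairing_def by (rule conjunct2)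
  ultimately show False using assms(2-6) by metis
qed

text \<open>The blocks of the Kreweras complement of \<open>p\<close>, that is, the orbits of \<open>g \<circ> p\<close>, described as
  the classes of the equivalence relation generated by \<open>z \<sim> g (p z)\<close>.\<close>

definition kinvariant :: "(nat \<Rightarrow> nat) \<Rightarrow> nat set \<Rightarrow> bool" where
  "kinvariant p I \<longleftrightarrow> (\<forall>z \<in> A. z \<in> I \<longleftrightarrow> g (p z) \<in> I)"

definition kblock :: "(nat \<Rightarrow> nat) \<Rightarrow> nat \<Rightarrow> nat set" where
  "kblock p x = {y \<in> A. \<forall>I. kinvariant p I \<longrightarrow> (x \<in> I \<longleftrightarrow> y \<in> I)}"

lemma kblock_self: "x \<in> A \<Longrightarrow> x \<in> kblock p x"
  by (simp add: kblock_def)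

lemma kblock_subset: "kblock p x \<subseteq> A"
  by (auto simp: kblock_def)

lemma kblock_eq_iff:
  assumes "x \<in> A" "y \<in> A"
  shows "kblock p x = kblock p y \<longleftrightarrow> (\<forall>I. kinvariant p I \<longrightarrow> (x \<in> I \<longleftrightarrow> y \<in> I))"
proof
  assume "kblock p x = kblock p y"
  then have "y \<in> kblock p x" using kblock_self[OF assms(2)] by simp
  then show "\<forall>I. kinvariant p I \<longrightarrow> (x \<in> I \<longleftrightarrow> y \<in> I)" by (simp add: kblock_def)
qed (simp add: kblock_def)

text \<open>Information about Kreweras classes is extracted by exhibiting an invariant set: below,
  first the intervals \<open>arc_between p a\<close>, later the blocks of a given partition.\<close>

lemma kblock_eqD:
  assumes "kblock p x = kblock p y" "x \<in> A" "y \<in> A" "\<And>z. z \<in> A \<Longrightarrow> z \<in> I \<longleftrightarrow> g (p z) \<in> I"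
  shows "x \<in> I \<longleftrightarrow> y \<in> I"
proof -
  have "kinvariant p I" using assms(4) unfolding kinvariant_def by blast
  then show ?thesis using assms(1) unfolding kblock_eq_iff[OF assms(2,3)] by blast
qed

lemma mem_kblock_iff:
  assumes "x \<in> A"
  shows "y \<in> kblock p x \<longleftrightarrow> y \<in> A \<and> kblock p y = kblock p x"
proof -
  have "y \<in> kblock p x \<longleftrightarrow> kblock p x = kblock p y" if "y \<in> A"
    unfolding kblock_eq_iff[OF assms that] using that by (simp add: kblock_def)
  then show ?thesis using kblock_subset[of p x] by auto
qed

lemma partition_on_kblock: "partition_on A (kblock p ` A)"
proof (rule partition_onI)
  show "\<Union> (kblock p ` A) = A" using kblock_self kblock_subset by blast
  show "disjnt B C" if "B \<in> kblock p ` A" "C \<in> kblock p ` A" "B \<noteq> C" for B C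
    using that mem_kblock_iff by (auto simp: disjnt_iff)
  show "{} \<notin> kblock p ` A" using kblock_self by blast
qed

lemma block_of_kblock: "x \<in> A \<Longrightarrow> block_of (kblock p ` A) x = kblock p x"
  by (rule block_of_eq[OF partition_on_kblock]) (auto intro: kblock_self)

text \<open>This is the generating relation at \<open>z = p x\<close>. It says that the tail of the
  arc \<open>x\<close> is the head of the arc \<open>p x\<close>, hence that the two arcs are
  opposite.\<close>

lemma kblock_g:
  assumes "nc_pairing p" "x \<in> A"
  shows "kblock p (g x) = kblock p (p x)"
proof -
  have "p x \<in> A" "g x = g (p (p x))" using nc_pairingD[OF assms] by auto
  moreover from this have "g x \<in> I \<longleftrightarrow> p x \<in> I" if "kinvariant p I" for I
    using that unfolding kinvariant_def by metis
  ultimately show ?thesis using kblock_eq_iff[OF g_mem[OF assms(2)]] by blast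
qed

text \<open>If \<open>x\<close> is \<open>a\<close> or \<open>p a\<close>, then \<open>p\<close>
  swaps these two, one of which is inside, and \<open>g\<close> crosses the boundary back. Any other
  \<open>x\<close> stays on its side under \<open>p\<close>, because its pair would otherwise cross
  \<open>{a, p a}\<close>, and also under \<open>g\<close>, because \<open>p x\<close> is not a
  boundary arc.\<close>

lemma arc_between_invariant:
  assumes p: "nc_pairing p" and a: "a \<in> A" and x: "x \<in> A"
  shows "x \<in> arc_between p a \<longleftrightarrow> g (p x) \<in> arc_between p a"
proof -
  note D = nc_pairingD[OF p]
  note step = arc_between_step[of a p "p x", OF a D(1,2)[OF a] D(1)[OF x]]
  show ?thesis
  proof (cases "x \<in> {a, p a}")
    case True
    then have "p x \<in> {a, p a}" using D(3)[OF a] by auto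
    moreover have "a \<in> arc_between p a \<longleftrightarrow> p a \<notin> arc_between p a"
      using D(2)[OF a] by (auto simp: arc_between_def)
    ultimately show ?thesis using step True D(3)[OF a] by auto
  next
    case False
    then have px: "p x \<notin> {a, p a}" using D a x by (metis insert_iff singletonD)
    obtain l h where lh: "l < h" "l \<in> A" "h \<in> A" "p l = h" "{a, p a} = {l, h}"
      "arc_between p a = {l<..h}"
    proof (cases "a < p a")
      case True
      then show ?thesis using that[of a "p a"] D(1)[OF a] a by (simp add: arc_between_def)
    next
      case False
      then show ?thesis using that[of "p a" a] D[OF a] a
        by (simp add: arc_between_def min_def max_def insert_commute)
    qed
    \<comment> \<open>If \<open>y\<close> is strictly inside and \<open>p y\<close> outside, the
      crossing is \<open>l < y < h < p y\<close> or \<open>p y < l < y < h\<close>.\<close>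
    have cross: "\<not> (l < y \<and> y < h \<and> (p y < l \<or> h < p y))" if "y \<in> A" for y
      using nc_pairing_not_crossing[OF p, of l y] nc_pairing_not_crossing[OF p, of "p y" l]
        lh D[OF that] that by auto
    have "x \<in> arc_between p a \<longleftrightarrow> p x \<in> arc_between p a"
      using cross[OF x] cross[OF D(1)[OF x]] D(3)[OF x] False px
      unfolding lh(5,6) by auto
    then show ?thesis using step px by simp
  qed
qed

lemma kblock_arc_between:
  assumes "nc_pairing p" "a \<in> A" "x \<in> A" "y \<in> A" "kblock p x = kblock p y"
  shows "x \<in> arc_between p a \<longleftrightarrow> y \<in> arc_between p a"
  by (rule kblock_eqD[OF assms(5,3,4)]) (rule arc_between_invariant[OF assms(1,2)])

text \<open>The interval of \<open>y\<close> separates the ends of the arc \<open>y\<close>, but not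
  those of an arc other than \<open>y\<close> and \<open>p y\<close>. So every edge has multiplicity
  exactly 2.\<close>

lemma kblock_ends_iff:
  assumes p: "nc_pairing p" and xy: "x \<in> A" "y \<in> A"
  shows "{kblock p x, kblock p (p x)} = {kblock p y, kblock p (p y)} \<longleftrightarrow> x \<in> {y, p y}"
proof
  note D = nc_pairingD[OF p]
  assume "{kblock p x, kblock p (p x)} = {kblock p y, kblock p (p y)}"
  then have ends: "{kblock p x, kblock p (g x)} = {kblock p y, kblock p (g y)}"
    using kblock_g[OF p] xy by simp
  note step = arc_between_step[of y p, OF xy(2) D(1,2)[OF xy(2)]]
  show "x \<in> {y, p y}"
  proof (rule ccontr)
    assume "x \<notin> {y, p y}"
    then have 1: "x \<in> arc_between p y \<longleftrightarrow> g x \<in> arc_between p y" using step xy by blast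
    have "y \<in> arc_between p y \<longleftrightarrow> g y \<notin> arc_between p y" using step xy by blast
    moreover have "g x \<in> A" "g y \<in> A" using g_mem xy by auto
    ultimately show False
      using 1 ends kblock_arc_between[OF p xy(2) xy(1) xy(2)]
        kblock_arc_between[OF p xy(2) xy(1) \<open>g y \<in> A\<close>]
        kblock_arc_between[OF p xy(2) \<open>g x \<in> A\<close> xy(2)]
        kblock_arc_between[OF p xy(2) \<open>g x \<in> A\<close> \<open>g y \<in> A\<close>]
      unfolding doubleton_eq_iff by blast
  qed
next
  assume "x \<in> {y, p y}"
  then consider "x = y" | "x = p y" by blast
  then show "{kblock p x, kblock p (p x)} = {kblock p y, kblock p (p y)}"
  proof cases
    case 2
    show ?thesis unfolding 2 nc_pairingD(3)[OF p xy(2)] by (rule insert_commute)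
  qed blast
qed

text \<open>The quotient has no loops: the interval of \<open>x\<close> itself separates
  \<open>x\<close> from \<open>g x\<close>, which is in the class of \<open>p x\<close>.\<close>

lemma kblock_neq:
  assumes p: "nc_pairing p" and "x \<in> A"
  shows "kblock p x \<noteq> kblock p (p x)"
proof
  note D = nc_pairingD[OF p \<open>x \<in> A\<close>]
  assume "kblock p x = kblock p (p x)"
  then have "kblock p x = kblock p (g x)" unfolding kblock_g[OF assms] .
  moreover have "x \<in> arc_between p x \<longleftrightarrow> g x \<notin> arc_between p x"
    using arc_between_step[of x p x, OF \<open>x \<in> A\<close> D(1,2) \<open>x \<in> A\<close>] by simp
  ultimately show False
    using kblock_arc_between[OF p \<open>x \<in> A\<close> \<open>x \<in> A\<close> g_mem[OF \<open>x \<in> A\<close>]] by argo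
qed

lemma arc_ends_kblock:
  assumes "nc_pairing p" "x \<in> A"
  shows "arc_ends g (kblock p ` A) x = {kblock p x, kblock p (p x)}"
  using assms g_mem by (auto simp: arc_ends_def block_of_kblock kblock_g)

lemma arc_class_kblock:
  assumes "nc_pairing p" "x \<in> A"
  shows "arc_class A g (kblock p ` A) x = {x, p x}"
proof -
  have "arc_class A g (kblock p ` A) x =
      {f \<in> A. {kblock p f, kblock p (p f)} = {kblock p x, kblock p (p x)}}"
    unfolding arc_class_def
    by (intro Collect_cong conj_cong refl) (simp only: arc_ends_kblock[OF assms(1)] assms(2))
  also have "\<dots> = {f \<in> A. f \<in> {x, p x}}"
    by (intro Collect_cong conj_cong refl kblock_ends_iff assms)
  finally show ?thesis using nc_pairingD(1)[OF assms] assms(2) by auto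
qed

text \<open>The pairs can be read off from the partition as the edge classes of its quotient
  graph.\<close>

lemma nc_pairing_eq_if_kblocks_eq:
  assumes "nc_pairing p" "nc_pairing p'" "kblock p ` A = kblock p' ` A" "x \<in> A"
  shows "p x = p' x"
proof -
  have "{x, p x} = {x, p' x}" using assms arc_class_kblock by metis
  then show ?thesis using nc_pairingD assms by (auto simp: doubleton_eq_iff)
qed

section \<open>Double trees as Kreweras partitions\<close>

lemma double_tree_kblock:
  assumes p: "nc_pairing p" and ne: "A \<noteq> {}"
  shows "double_tree (quot A g (kblock p ` A))"
proof -
  note D = nc_pairingD[OF p]
  let ?Q = "kblock p ` A"
  let ?G = "elementarization (quot A g ?Q)"
  have cut: "\<exists>X. cut_set ?G C X" if "C \<in> uedges ?G" for C
  proof -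
    obtain a where a: "a \<in> A" "C = arc_class A g ?Q a" using \<open>C \<in> uedges ?G\<close> by (auto simp: uedges_quot)
    \<comment> \<open>A class that meets the interval lies inside it, so \<open>X\<close> consists
      of the vertices on one side of the edge \<open>{a, p a}\<close>.\<close>
    define X where "X = {B. B \<inter> arc_between p a \<noteq> {}}"
    have X: "kblock p x \<in> X \<longleftrightarrow> x \<in> arc_between p a" if "x \<in> A" for x
    proof
      assume "kblock p x \<in> X"
      then obtain y where "y \<in> kblock p x" "y \<in> arc_between p a" by (auto simp: X_def)
      then show "x \<in> arc_between p a"
        using kblock_arc_between[OF p a(1), of x y] mem_kblock_iff[OF that, of y] that by auto
    next
      assume "x \<in> arc_between p a"
      then show "kblock p x \<in> X" using kblock_self[OF that] by (auto simp: X_def)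
    qed
    have "cut_set ?G C X"
      unfolding a(2) cut_set_quot_iff[OF a(1)]
    proof
      fix f assume f: "f \<in> A"
      then show "(block_of ?Q f \<in> X \<longleftrightarrow> block_of ?Q (g f) \<in> X) \<longleftrightarrow> f \<notin> arc_class A g ?Q a"
        using X g_mem arc_between_step[of a p f, OF a(1) D(1,2)[OF a(1)] f]
        by (simp add: block_of_kblock arc_class_kblock[OF p a(1)])
    qed
    then show ?thesis ..
  qed
  have "utree ?G"
    unfolding utree_def
    using uconnected_quot[OF partition_on_kblock ne] no_ucycle_if_cut_sets[of ?G] cut by blast
  moreover have "\<exists>e f. e \<noteq> f \<and> C = {e, f} \<and> tail (quot A g ?Q) e = head (quot A g ?Q) f \<and>
      head (quot A g ?Q) e = tail (quot A g ?Q) f" if "C \<in> uedges ?G" for C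
  proof -
    obtain a where a: "a \<in> A" "C = {a, p a}"
      using \<open>C \<in> uedges ?G\<close> arc_class_kblock[OF p] by (auto simp: uedges_quot)
    then show ?thesis
      using D[OF a(1)] kblock_g[OF p a(1)] kblock_g[OF p D(1)[OF a(1)]] g_mem
      by (intro exI[of _ a] exI[of _ "p a"])
        (auto simp: quotient_graph_def perm_graph_def block_of_kblock)
  qed
  ultimately show ?thesis unfolding double_tree_def by blast
qed

text \<open>The partner \<open>p x\<close> is the opposite arc in the edge of \<open>x\<close>.
  Opposite orientation makes every block of \<open>Q\<close> a union of Kreweras classes; the cuts
  of the tree give the rest, namely that \<open>p\<close> does not cross and that a block is a
  single class.\<close>

lemma double_tree_obtains_pairing:
  assumes Q: "partition_on A Q" and dt: "double_tree (quot A g Q)"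
  obtains p where "nc_pairing p" "\<And>x. x \<notin> A \<Longrightarrow> p x = x" "Q = kblock p ` A"
proof -
  let ?G = "elementarization (quot A g Q)"
  let ?b = "block_of Q"
  note mem = block_of_mem[OF Q] and eq = block_of_eq[OF Q]
  \<comment> \<open>The witness is the other arc of the edge; the orientation condition is
    symmetric, so \<open>x\<close> may be either of \<open>e\<close> and \<open>f\<close>.\<close>
  have "\<exists>f. x \<in> A \<longrightarrow> f \<noteq> x \<and> arc_class A g Q x = {x, f} \<and> ?b (g x) = ?b f \<and> ?b x = ?b (g f)" for x
  proof (cases "x \<in> A")
    case True
    then have "arc_class A g Q x \<in> uedges ?G" by (simp add: uedges_quot)
    then obtain e f where ef: "e \<noteq> f" "arc_class A g Q x = {e, f}" "?b (g e) = ?b f" "?b e = ?b (g f)"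
      using dt unfolding double_tree_def by (auto simp: quotient_graph_def perm_graph_def)
    then have "x \<in> {e, f}" using arc_class_self[OF True] by blast
    then show ?thesis using ef by (metis insert_commute insertE singletonD)
  qed blast
  then obtain p0 where p0: "\<And>x. x \<in> A \<Longrightarrow>
      p0 x \<noteq> x \<and> arc_class A g Q x = {x, p0 x} \<and> ?b (g x) = ?b (p0 x) \<and> ?b x = ?b (g (p0 x))"
    by metis
  define p where "p x = (if x \<in> A then p0 x else x)" for x
  have p: "p x \<noteq> x" "arc_class A g Q x = {x, p x}" "?b (g x) = ?b (p x)" "?b x = ?b (g (p x))"
    if "x \<in> A" for x
    using p0 that by (auto simp: p_def)
  have p_mem: "p x \<in> A" if "x \<in> A" for x
    using p(2)[OF that] by (auto simp: arc_class_def)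
  have p_p: "p (p x) = x" if "x \<in> A" for x
  proof -
    have "p x \<in> arc_class A g Q x" using p(2)[OF that] by blast
    then have "arc_class A g Q (p x) = arc_class A g Q x" by (auto simp: arc_class_def)
    then show ?thesis using p(1,2) that p_mem by (metis doubleton_eq_iff)
  qed
  have cut: "x \<in> arc_between p a \<longleftrightarrow> y \<in> arc_between p a"
    if "a \<in> A" "x \<in> A" "y \<in> A" "?b x = ?b y" for a x y
  proof -
    have V: "uends ?G f \<subseteq> uverts ?G" if "f \<in> uedges ?G" for f
      using that mem g_mem by (auto simp: uedges_quot uends_quot arc_ends_def uverts_quot)
    have N: "\<nexists>vs es. ucycle ?G vs es" using dt by (simp add: double_tree_def utree_def)
    have E: "arc_class A g Q a \<in> uedges ?G"
      unfolding uedges_quot using \<open>a \<in> A\<close> by (rule imageI)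
    have U: "uends ?G (arc_class A g Q a) = {?b (g a), ?b a}"
      unfolding uends_quot[OF \<open>a \<in> A\<close>] arc_ends_def ..
    from no_ucycle_obtains_cut_set[OF N E U V]
    obtain X where X: "cut_set ?G (arc_class A g Q a) X" .
    \<comment> \<open>Pulled back to the cycle, the cut changes side exactly at \<open>a\<close> and
      \<open>p a\<close>, so it agrees with the interval up to complement.\<close>
    have "(x \<in> ?b -` X \<longleftrightarrow> y \<in> ?b -` X) \<longleftrightarrow> (x \<in> arc_between p a \<longleftrightarrow> y \<in> arc_between p a)"
    proof (rule constant_across_arc_between)
      fix z assume "z \<in> A"
      with X have "(?b z \<in> X \<longleftrightarrow> ?b (g z) \<in> X) \<longleftrightarrow> z \<notin> arc_class A g Q a"
        unfolding cut_set_quot_iff[OF \<open>a \<in> A\<close>] by blast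
      then show "(z \<in> ?b -` X \<longleftrightarrow> g z \<in> ?b -` X) \<longleftrightarrow> z \<notin> {a, p a}"
        unfolding p(2)[OF \<open>a \<in> A\<close>] by simp
    qed (use that p_mem p(1) in auto)
    then show ?thesis using that by simp
  qed
  have nc: "nc_pairing p"
    unfolding nc_pairing_def
  proof (intro conjI ballI notI)
    assume "\<exists>a \<in> A. \<exists>b \<in> A. \<exists>c \<in> A. \<exists>d \<in> A. a < b \<and> b < c \<and> c < d \<and> p a = c \<and> p b = d"
    then obtain a b where ab: "a \<in> A" "b \<in> A" "p b \<in> A" "a < b" "b < p a" "p a < p b" by blast
    have "g (p b) \<in> A" "?b b = ?b (g (p b))" using g_mem[OF ab(3)] p(4)[OF ab(2)] by auto
    then have "b \<in> arc_between p a \<longleftrightarrow> g (p b) \<in> arc_between p a" using cut ab by blast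
    moreover have "b \<in> arc_between p a" using ab by (simp add: arc_between_def)
    \<comment> \<open>The point \<open>g (p b)\<close> is \<open>Suc (p b)\<close>, beyond
      \<open>p a\<close>, or it is \<open>lo\<close>, which is at most \<open>a\<close>.\<close>
    moreover have "g (p b) \<notin> arc_between p a"
      using ab(3) by (rule g_cases) (use ab in \<open>auto simp: arc_between_def\<close>)
    ultimately show False by blast
  qed (use p(1) p_mem p_p in auto)
  \<comment> \<open>The cut at \<open>i\<close> forces \<open>i < p i < j\<close>. The point
    \<open>Suc (p i) = g (p i)\<close> shares with \<open>i\<close> both the block of
    \<open>Q\<close> and the Kreweras class, and it is closer to \<open>j\<close>.\<close>
  have up: "kblock p i = kblock p j" if "i < j" "i \<in> A" "j \<in> A" "?b i = ?b j" for i j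
    using that
  proof (induction "j - i" arbitrary: i rule: less_induct)
    case less
    have "p i \<in> A" "p i \<noteq> i" using p(1) p_mem less.prems(2) by auto
    have "i \<in> arc_between p i \<longleftrightarrow> j \<in> arc_between p i" using cut less by blast
    then have *: "i < p i" "p i < j" using less.prems(1) \<open>p i \<noteq> i\<close>
      by (auto simp: arc_between_def min_def max_def split: if_splits)
    then have g: "g (p i) = Suc (p i)" using g_step less.prems by auto
    have "kblock p (g (p i)) = kblock p (p (p i))" using kblock_g[OF nc \<open>p i \<in> A\<close>] .
    then have 1: "kblock p i = kblock p (Suc (p i))" using g p_p less by simp
    have 2: "?b (Suc (p i)) = ?b j" using p(4)[of i] g less by simp
    show ?case
    proof (cases "Suc (p i) = j")
      case False
      then have "kblock p (Suc (p i)) = kblock p j"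
        using * less.prems 2 by (intro less.hyps) auto
      with 1 show ?thesis by simp
    qed (use 1 in simp)
  qed
  have b: "kblock p i = ?b i" if i: "i \<in> A" for i
  proof
    show "?b i \<subseteq> kblock p i"
    proof
      fix j assume j: "j \<in> ?b i"
      then have "j \<in> A" using mem(1)[OF i] Q unfolding partition_on_def by blast
      moreover have "?b j = ?b i" by (rule eq[OF mem(1)[OF i] j])
      ultimately have "kblock p j = kblock p i"
        using up[of i j] up[of j i] i by (metis nat_neq_iff)
      then show "j \<in> kblock p i" using mem_kblock_iff[OF i] \<open>j \<in> A\<close> by blast
    qed
    show "kblock p i \<subseteq> ?b i"
    proof
      fix j assume j: "j \<in> kblock p i"
      then have "j \<in> A" "kblock p j = kblock p i" using mem_kblock_iff[OF i] by auto
      \<comment> \<open>A block of \<open>Q\<close> is an invariant set because the arcs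
        \<open>z\<close> and \<open>p z\<close> are opposite.\<close>
      have "z \<in> {z. ?b z = ?b i} \<longleftrightarrow> g (p z) \<in> {z. ?b z = ?b i}" if "z \<in> A" for z
        using p(4)[OF that] by simp
      from kblock_eqD[OF \<open>kblock p j = kblock p i\<close> \<open>j \<in> A\<close> i this]
      have "j \<in> {z. ?b z = ?b i} \<longleftrightarrow> i \<in> {z. ?b z = ?b i}" .
      then have "?b j = ?b i" by simp
      then show "j \<in> ?b i" using mem(2)[OF \<open>j \<in> A\<close>] by simp
    qed
  qed
  have "Q = ?b ` A" using block_of_image_eq[OF Q] ..
  also have "\<dots> = kblock p ` A" using b by (intro image_cong) auto
  finally have "Q = kblock p ` A" .
  moreover have "p x = x" if "x \<notin> A" for x unfolding p_def using that by (rule if_not_P)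
  ultimately show thesis using that[OF nc] by blast
qed

lemma nc_pairing_cong:
  assumes "\<And>x. x \<in> A \<Longrightarrow> p x = q x" and p: "nc_pairing p"
  shows "nc_pairing q"
  unfolding nc_pairing_def
proof (intro conjI ballI)
  note D = nc_pairingD[OF p]
  fix x assume x: "x \<in> A"
  have q: "q x = p x" "q (p x) = p (p x)" using assms(1)[OF x] assms(1)[OF D(1)[OF x]] by auto
  show "q x \<in> A" "q x \<noteq> x" "q (q x) = x" unfolding q using D[OF x] by auto
next
  show "\<not> (\<exists>a \<in> A. \<exists>b \<in> A. \<exists>c \<in> A. \<exists>d \<in> A. a < b \<and> b < c \<and> c < d \<and> q a = c \<and> q b = d)"
    using p assms(1) unfolding nc_pairing_def by metis
qed

lemma kblock_cong:
  assumes "\<And>x. x \<in> A \<Longrightarrow> p x = q x"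
  shows "kblock p = kblock q"
proof -
  have "kinvariant p = kinvariant q" using assms by (intro ext) (simp add: kinvariant_def)
  then show ?thesis by (intro ext) (simp add: kblock_def)
qed

end

section \<open>Gluing three cycles\<close>

lemma partition_on_image:
  assumes "\<And>x. x \<in> A \<Longrightarrow> x \<in> b x" "\<And>x. x \<in> A \<Longrightarrow> b x \<subseteq> A"
    and "\<And>x y. x \<in> A \<Longrightarrow> y \<in> b x \<Longrightarrow> b y = b x"
  shows "partition_on A (b ` A)"
proof (rule partition_onI)
  show "\<Union> (b ` A) = A" using assms(1,2) by blast
  show "disjnt B C" if "B \<in> b ` A" "C \<in> b ` A" "B \<noteq> C" for B C
    using that assms(3) unfolding disjnt_iff by (metis imageE)
  show "{} \<notin> b ` A" using assms(1) by blast
qed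

lemma card_eq_mult_card_image:
  assumes "finite D" and "\<And>x. x \<in> D \<Longrightarrow> card {y \<in> D. f y = f x} = k"
  shows "card D = k * card (f ` D)"
proof -
  have "card D = (\<Sum>t \<in> f ` D. card {y \<in> D. f y = t})"
    unfolding card_eq_sum by (rule sum.image_gen[OF assms(1)])
  also have "\<dots> = (\<Sum>t \<in> f ` D. k)" using assms(2) by (intro sum.cong) auto
  finally show ?thesis by simp
qed

lemma less_3_cases: "j < 3 \<longleftrightarrow> j = 0 \<or> j = 1 \<or> j = (2::nat)"
  by auto

lemma orbit_involution:
  assumes "q (q x) = x"
  shows "orbit q x = {x, q x}"
proof
  show "orbit q x \<subseteq> {x, q x}"
  proof
    fix y assume "y \<in> orbit q x"
    then show "y \<in> {x, q x}" by induction (use assms in auto)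
  qed
  show "{x, q x} \<subseteq> orbit q x"
    using orbit.base[of q x] orbit.step[OF orbit.base[of q x]] assms by auto
qed

section \<open>Three disjoint cycles\<close>

locale three_cycles =
  fixes lo hi :: "nat \<Rightarrow> nat" and g :: "nat \<Rightarrow> nat"
  assumes cycle: "\<And>j. j < 3 \<Longrightarrow> interval_cycle (lo j) (hi j) g"
    and disjoint: "\<And>i j. i < 3 \<Longrightarrow> j < 3 \<Longrightarrow> i \<noteq> j \<Longrightarrow> {lo i..<hi i} \<inter> {lo j..<hi j} = {}"
begin

definition A :: "nat \<Rightarrow> nat set" where "A j = {lo j..<hi j}"

definition M :: "nat set" where "M = (\<Union>j<3. A j)"

definition pairing :: "(nat \<Rightarrow> nat) \<Rightarrow> bool" where
  "pairing p \<longleftrightarrow> (\<forall>j<3. interval_cycle.nc_pairing (lo j) (hi j) p)"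

definition index :: "nat \<Rightarrow> nat" where "index x = (THE j. j < 3 \<and> x \<in> A j)"

definition kb :: "(nat \<Rightarrow> nat) \<Rightarrow> nat \<Rightarrow> nat set" where
  "kb p x = interval_cycle.kblock (lo (index x)) (hi (index x)) g p x"

lemma A_unique: "i < 3 \<Longrightarrow> j < 3 \<Longrightarrow> x \<in> A i \<Longrightarrow> x \<in> A j \<Longrightarrow> i = j"
  using disjoint[of i j] by (auto simp: A_def)

lemma M_E:
  assumes "x \<in> M"
  obtains j where "j < 3" "x \<in> A j"
  using assms by (auto simp: M_def)

lemma A_subset_M: "j < 3 \<Longrightarrow> A j \<subseteq> M"
  by (auto simp: M_def)

lemma in_M: "j < 3 \<Longrightarrow> x \<in> A j \<Longrightarrow> x \<in> M"
  by (auto simp: M_def)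

lemma eq_if_Int_A_eq:
  assumes "X \<subseteq> M" "Y \<subseteq> M" "\<And>j. j < 3 \<Longrightarrow> X \<inter> A j = Y \<inter> A j"
  shows "X = Y"
proof -
  have "X = (\<Union>j<3. X \<inter> A j)" "Y = (\<Union>j<3. Y \<inter> A j)" using assms(1,2) by (auto simp: M_def)
  moreover have "(\<Union>j<3. X \<inter> A j) = (\<Union>j<3. Y \<inter> A j)" using assms(3) by (intro SUP_cong) auto
  ultimately show ?thesis by simp
qed

lemma finite_M: "finite M"
  by (simp add: M_def A_def)

lemma index_eq: "j < 3 \<Longrightarrow> x \<in> A j \<Longrightarrow> index x = j"
  unfolding index_def using A_unique by (intro the_equality) auto

lemma kb_eq: "j < 3 \<Longrightarrow> x \<in> A j \<Longrightarrow> kb p x = interval_cycle.kblock (lo j) (hi j) g p x"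
  by (simp add: kb_def index_eq)

lemma kb_image:
  assumes "j < 3"
  shows "kb p ` A j = interval_cycle.kblock (lo j) (hi j) g p ` A j"
  using kb_eq[OF assms] by (intro image_cong) auto

lemma g_mem: "j < 3 \<Longrightarrow> x \<in> A j \<Longrightarrow> g x \<in> A j"
  using interval_cycle.g_mem[OF cycle] by (simp add: A_def)

lemma pairingD:
  assumes "pairing p" "j < 3" "x \<in> A j"
  shows "p x \<in> A j" "p x \<noteq> x" "p (p x) = x"
  using interval_cycle.nc_pairingD[OF cycle[OF assms(2)]] assms by (auto simp: A_def pairing_def)

lemma kb_self: "x \<in> M \<Longrightarrow> x \<in> kb p x"
  by (erule M_E) (simp add: kb_eq A_def interval_cycle.kblock_self[OF cycle])

lemma kb_subset: "j < 3 \<Longrightarrow> x \<in> A j \<Longrightarrow> kb p x \<subseteq> A j"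
  using kb_eq interval_cycle.kblock_subset[OF cycle] by (simp add: A_def)

lemma kb_eq_if_mem:
  assumes "x \<in> M" "y \<in> kb p x"
  shows "kb p y = kb p x"
proof -
  obtain j where j: "j < 3" "x \<in> A j" using assms by (auto elim: M_E)
  then have "y \<in> A j" using kb_subset assms(2) by blast
  then show ?thesis
    using interval_cycle.mem_kblock_iff[OF cycle[OF j(1)], of x y p] j assms(2)
    by (simp add: kb_eq A_def)
qed

lemma kb_g:
  assumes "pairing p" "j < 3" "x \<in> A j"
  shows "kb p (g x) = kb p (p x)"
  using assms interval_cycle.kblock_g[OF cycle[OF assms(2)], of p x] g_mem[OF assms(2,3)]
    pairingD(1)[OF assms] kb_eq[OF assms(2)]
  by (simp add: A_def pairing_def)

lemma kb_neq:
  assumes "pairing p" "j < 3" "x \<in> A j"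
  shows "kb p x \<noteq> kb p (p x)"
  using assms interval_cycle.kblock_neq[OF cycle[OF assms(2)], of p x]
    pairingD(1)[OF assms] kb_eq[OF assms(2)]
  by (simp add: A_def pairing_def)

lemma kb_ends_iff:
  assumes "pairing p" "j < 3" "x \<in> A j" "y \<in> A j"
  shows "{kb p x, kb p (p x)} = {kb p y, kb p (p y)} \<longleftrightarrow> x \<in> {y, p y}"
  using interval_cycle.kblock_ends_iff[OF cycle[OF assms(2)], of p x y] assms
    pairingD(1)[OF assms(1,2)] kb_eq[OF assms(2)]
  by (simp add: A_def pairing_def)

text \<open>An arc is determined by its ordered ends: the only other arc of its edge is the opposite
  one, and there are no loops.\<close>

lemma kb_inject:
  assumes p: "pairing p" and j: "j < 3" "x \<in> A j" "y \<in> A j"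
    and eq: "kb p x = kb p y" "kb p (p x) = kb p (p y)"
  shows "x = y"
proof (rule ccontr)
  assume "x \<noteq> y"
  then have "x = p y" using kb_ends_iff[OF p j] eq by simp
  then show False using kb_neq[OF p j(1,3)] eq(1) by simp
qed

lemma arc_class_kb:
  assumes "pairing p" "j < 3" "x \<in> A j"
  shows "arc_class (A j) g (kb p ` A j) x = {x, p x}"
  using interval_cycle.arc_class_kblock[OF cycle[OF assms(2)], of p x] assms
  unfolding kb_image[OF assms(2)] by (simp add: A_def pairing_def)

lemma pairing_eq_if_kb_images_eq:
  assumes "pairing p" "pairing p'" "j < 3" "kb p ` A j = kb p' ` A j" "x \<in> A j"
  shows "p x = p' x"
  using interval_cycle.nc_pairing_eq_if_kblocks_eq[OF cycle[OF assms(3)], of p p' x] assms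
  unfolding kb_image[OF assms(3)] by (simp add: A_def pairing_def)

lemma double_tree_kb:
  assumes "pairing p" "j < 3" "A j \<noteq> {}"
  shows "double_tree (quot (A j) g (kb p ` A j))"
  using interval_cycle.double_tree_kblock[OF cycle[OF assms(2)], of p] assms
  unfolding kb_image[OF assms(2)] by (simp add: A_def pairing_def)

lemma double_trees_obtain_pairing:
  assumes Q: "\<And>j. j < 3 \<Longrightarrow> partition_on (A j) (Q j)"
    and dt: "\<And>j. j < 3 \<Longrightarrow> double_tree (quot (A j) g (Q j))"
  obtains p where "pairing p" "\<And>x. x \<notin> M \<Longrightarrow> p x = x" "\<And>j. j < 3 \<Longrightarrow> Q j = kb p ` A j"
proof -
  have "\<exists>q. interval_cycle.nc_pairing (lo j) (hi j) q \<and>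
      Q j = interval_cycle.kblock (lo j) (hi j) g q ` A j" if "j < 3" for j
    using interval_cycle.double_tree_obtains_pairing[OF cycle[OF that], of "Q j"] Q[OF that] dt[OF that]
    unfolding A_def by metis
  then obtain q where q: "\<And>j. j < 3 \<Longrightarrow> interval_cycle.nc_pairing (lo j) (hi j) (q j)"
    "\<And>j. j < 3 \<Longrightarrow> Q j = interval_cycle.kblock (lo j) (hi j) g (q j) ` A j" by metis
  \<comment> \<open>The value off \<open>M\<close> is fixed as the identity, so that
    \<open>p\<close> is determined by its three restrictions and counting functions counts triples
    of pairings.\<close>
  define p where "p x = (if x \<in> M then q (index x) x else x)" for x
  have p: "p x = q j x" if "j < 3" "x \<in> {lo j..<hi j}" for j x
    using that index_eq in_M by (simp add: p_def A_def)
  show thesis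
  proof (rule that[of p])
    show "pairing p"
      unfolding pairing_def
    proof (intro allI impI)
      fix j :: nat assume j: "j < 3"
      show "interval_cycle.nc_pairing (lo j) (hi j) p"
        using interval_cycle.nc_pairing_cong[OF cycle[OF j] _ q(1)[OF j], of p] p[OF j] by simp
    qed
    show "p x = x" if "x \<notin> M" for x using that by (simp add: p_def)
    show "Q j = kb p ` A j" if "j < 3" for j
      unfolding kb_image[OF that] q(2)[OF that]
      using interval_cycle.kblock_cong[OF cycle[OF that] p[OF that]] by simp
  qed
qed

section \<open>Choices of three pairings and three arcs\<close>

text \<open>A triple of pairings is encoded by its product, a single involution of
  \<open>M\<close>.\<close>

definition S :: "(nat \<Rightarrow> nat) set" where
  "S = {p. pairing p \<and> (\<forall>x. x \<notin> M \<longrightarrow> p x = x)}"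

text \<open>\<open>PiE\<close> fixes the value of \<open>d\<close> outside \<open>{..<3}\<close>, so
  that \<open>d\<close> is nothing but a triple of arcs.\<close>

definition D :: "((nat \<Rightarrow> nat) \<times> (nat \<Rightarrow> nat)) set" where
  "D = S \<times> PiE {..<3} A"

definition flip :: "(nat \<Rightarrow> nat) \<Rightarrow> (nat \<Rightarrow> nat) \<Rightarrow> nat \<Rightarrow> nat" where
  "flip p d = (\<lambda>j \<in> {..<3}. p (d j))"

text \<open>These are the glued heads of the chosen arcs. The tail of an arc is the head of its
  partner, so \<open>merged p (flip p d)\<close> consists of the glued tails.\<close>

definition merged :: "(nat \<Rightarrow> nat) \<Rightarrow> (nat \<Rightarrow> nat) \<Rightarrow> nat set" where
  "merged p d = (\<Union>j<3. kb p (d j))"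

definition gblock :: "(nat \<Rightarrow> nat) \<Rightarrow> (nat \<Rightarrow> nat) \<Rightarrow> nat \<Rightarrow> nat set" where
  "gblock p d x = (if x \<in> merged p d then merged p d
     else if x \<in> merged p (flip p d) then merged p (flip p d) else kb p x)"

text \<open>The same six points are the arcs of the edge of multiplicity 6 and the large block of
  the partitioned permutation.\<close>

definition common_edge :: "(nat \<Rightarrow> nat) \<Rightarrow> (nat \<Rightarrow> nat) \<Rightarrow> nat set" where
  "common_edge p d = (\<Union>j<3. {d j, p (d j)})"

definition pblock :: "(nat \<Rightarrow> nat) \<Rightarrow> (nat \<Rightarrow> nat) \<Rightarrow> nat \<Rightarrow> nat set" where
  "pblock p d x = (if x \<in> common_edge p d then common_edge p d else {x, p x})"

lemma D_D:
  assumes "(p, d) \<in> D"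
  shows "pairing p" "\<And>x. x \<notin> M \<Longrightarrow> p x = x" "\<And>j. j < 3 \<Longrightarrow> d j \<in> A j"
    "\<And>j. \<not> j < 3 \<Longrightarrow> d j = undefined"
  using assms by (auto simp: D_def S_def PiE_def extensional_def)

lemma flip_apply: "j < 3 \<Longrightarrow> flip p d j = p (d j)"
  by (simp add: flip_def)

lemma flip_in_D: "(p, d) \<in> D \<Longrightarrow> (p, flip p d) \<in> D"
proof -
  assume pd: "(p, d) \<in> D"
  have "p (d j) \<in> A j" if "j < 3" for j using pairingD(1)[OF D_D(1)[OF pd] that D_D(3)[OF pd that]] .
  then show ?thesis using pd by (auto simp: D_def flip_def)
qed

lemma flip_flip:
  assumes "(p, d) \<in> D"
  shows "flip p (flip p d) = d"
proof
  fix j show "flip p (flip p d) j = d j"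
    using D_D[OF assms] pairingD(3)[of p j "d j"] by (cases "j < 3") (auto simp: flip_def)
qed

lemma merged_Int:
  assumes "(p, d) \<in> D" "j < 3"
  shows "merged p d \<inter> A j = kb p (d j)"
proof -
  have "kb p (d i) \<subseteq> A i" if "i < 3" for i using kb_subset[OF that] D_D[OF assms(1)] that by blast
  then show ?thesis using A_unique assms(2) unfolding merged_def by blast
qed

lemma merged_subset: "(p, d) \<in> D \<Longrightarrow> merged p d \<subseteq> M"
proof
  fix x
  assume "(p, d) \<in> D" "x \<in> merged p d"
  then obtain j where j: "j < 3" "x \<in> kb p (d j)" "d j \<in> A j"
    using D_D(3) unfolding merged_def by blast
  then show "x \<in> M" using kb_subset[OF j(1,3)] in_M[OF j(1)] by blast
qed

lemma merged_not_subset: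
  assumes "(p, d) \<in> D" "j < 3"
  shows "\<not> merged p d \<subseteq> A j"
proof
  assume sub: "merged p d \<subseteq> A j"
  define i :: nat where "i = (if j = 0 then 1 else 0)"
  have i: "i < 3" "i \<noteq> j" by (auto simp: i_def)
  have "d i \<in> A i" using D_D(3)[OF assms(1) i(1)] .
  moreover from this have "d i \<in> merged p d"
    using kb_self[of "d i" p] in_M i(1) unfolding merged_def by blast
  ultimately show False using sub A_unique assms(2) i by blast
qed

lemma merged_mem_kb:
  assumes "(p, d) \<in> D" "j < 3" "x \<in> A j" "x \<in> merged p d"
  shows "kb p x = kb p (d j)"
  using merged_Int[OF assms(1,2)] kb_eq_if_mem[of "d j" x p] D_D(3)[OF assms(1,2)] assms in_M by blast

text \<open>A common point would make the head and the tail of \<open>d j\<close> the same vertex of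
  its tree, that is, a loop.\<close>

lemma merged_disjoint:
  assumes "(p, d) \<in> D"
  shows "merged p d \<inter> merged p (flip p d) = {}"
proof (rule ccontr)
  assume "merged p d \<inter> merged p (flip p d) \<noteq> {}"
  then obtain x where x: "x \<in> merged p d" "x \<in> merged p (flip p d)" by blast
  then obtain j where j: "j < 3" "x \<in> A j" using merged_subset[OF assms] by (blast elim: M_E)
  then have "kb p (d j) = kb p (p (d j))"
    using merged_mem_kb[OF assms j x(1)] merged_mem_kb[OF flip_in_D[OF assms] j x(2)] by (simp add: flip_apply)
  then show False using kb_neq D_D[OF assms] j by blast
qed

text \<open>Glueing identifies no two vertices of the same tree, since a glued block takes just one
  vertex from each.\<close>

lemma gblock_Int:
  assumes "(p, d) \<in> D" "j < 3" "x \<in> A j"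
  shows "gblock p d x \<inter> A j = kb p x"
  using merged_mem_kb[OF assms] merged_mem_kb[OF flip_in_D[OF assms(1)] assms(2,3)]
    merged_Int[OF assms(1,2)] merged_Int[OF flip_in_D[OF assms(1)] assms(2)]
    kb_subset[OF assms(2,3)]
  by (auto simp: gblock_def)

lemma gblock_self: "x \<in> M \<Longrightarrow> x \<in> gblock p d x"
  using kb_self by (simp add: gblock_def)

lemma gblock_flip:
  assumes "(p, d) \<in> D"
  shows "gblock p (flip p d) = gblock p d"
  unfolding gblock_def flip_flip[OF assms] using merged_disjoint[OF assms] by (intro ext) auto

lemma partition_on_gblock:
  assumes "(p, d) \<in> D"
  shows "partition_on M (gblock p d ` M)"
proof (rule partition_on_image)
  fix x assume x: "x \<in> M"
  then obtain j where j: "j < 3" "x \<in> A j" by (rule M_E)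
  show "gblock p d x \<subseteq> M"
    using merged_subset[OF assms] merged_subset[OF flip_in_D[OF assms]]
      order_trans[OF kb_subset[OF j] A_subset_M[OF j(1)]]
    unfolding gblock_def by auto
  fix y assume y: "y \<in> gblock p d x"
  show "gblock p d y = gblock p d x"
  proof (cases "x \<in> merged p d \<or> x \<in> merged p (flip p d)")
    case True
    then show ?thesis using y merged_disjoint[OF assms] by (auto simp: gblock_def split: if_splits)
  next
    case False
    then have y': "y \<in> kb p x" using y by (simp add: gblock_def)
    have yj: "y \<in> A j" using y' kb_subset[OF j] by blast
    have xy: "kb p y = kb p x" by (rule kb_eq_if_mem[OF x y'])
    \<comment> \<open>A glued block is a union of whole classes, so it contains \<open>x\<close> as
      soon as it contains \<open>y\<close>.\<close>
    have notin: "y \<notin> merged p d'" if d': "(p, d') \<in> D" "x \<notin> merged p d'" for d'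
    proof
      assume "y \<in> merged p d'"
      then have "kb p x = kb p (d' j)" using merged_mem_kb[OF d'(1) j(1) yj] xy by simp
      then have "x \<in> merged p d'" using kb_self[OF x, of p] j(1) unfolding merged_def by blast
      with d' show False by blast
    qed
    have "y \<notin> merged p d" "y \<notin> merged p (flip p d)"
      using notin[OF assms] notin[OF flip_in_D[OF assms]] False by auto
    then show ?thesis using False xy by (simp add: gblock_def)
  qed
qed (rule gblock_self)

lemma block_of_gblock: "(p, d) \<in> D \<Longrightarrow> x \<in> M \<Longrightarrow> block_of (gblock p d ` M) x = gblock p d x"
  by (rule block_of_eq[OF partition_on_gblock]) (auto intro: gblock_self)

lemma restrict_partition_gblock:
  assumes "(p, d) \<in> D" "j < 3"
  shows "restrict_partition (gblock p d ` M) (A j) = kb p ` A j"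
proof
  show "restrict_partition (gblock p d ` M) (A j) \<subseteq> kb p ` A j"
  proof
    fix B assume "B \<in> restrict_partition (gblock p d ` M) (A j)"
    then obtain x y where x: "x \<in> M" "B = gblock p d x \<inter> A j" and y: "y \<in> gblock p d x" "y \<in> A j"
      by (auto simp: restrict_partition_def)
    have "y \<in> M" using in_M y assms(2) by blast
    have "gblock p d y = gblock p d x"
      using block_of_eq[OF partition_on_gblock[OF assms(1)] imageI[OF x(1)] y(1)]
        block_of_gblock[OF assms(1) \<open>y \<in> M\<close>] by simp
    then show "B \<in> kb p ` A j" using gblock_Int[OF assms y(2)] x y by auto
  qed
  show "kb p ` A j \<subseteq> restrict_partition (gblock p d ` M) (A j)"
  proof
    fix B assume "B \<in> kb p ` A j"
    then obtain x where x: "x \<in> A j" "B = kb p x" by blast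
    have "x \<in> M" using in_M x assms(2) by blast
    then have "B \<noteq> {}" using kb_self x by blast
    then show "B \<in> restrict_partition (gblock p d ` M) (A j)"
      using gblock_Int[OF assms x(1)] x(2) \<open>x \<in> M\<close> unfolding restrict_partition_def by blast
  qed
qed

lemma common_edge_Int:
  assumes "(p, d) \<in> D" "j < 3"
  shows "common_edge p d \<inter> A j = {d j, p (d j)}"
proof -
  have "{d i, p (d i)} \<subseteq> A i" if "i < 3" for i
    using pairingD(1) D_D[OF assms(1)] that by blast
  then show ?thesis using A_unique assms(2) unfolding common_edge_def by blast
qed

lemma common_edge_subset: "(p, d) \<in> D \<Longrightarrow> common_edge p d \<subseteq> M"
proof
  fix x
  assume pd: "(p, d) \<in> D" and "x \<in> common_edge p d"
  then obtain j where j: "j < 3" "x \<in> {d j, p (d j)}" unfolding common_edge_def by blast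
  have "d j \<in> A j" using D_D(3)[OF pd j(1)] .
  then show "x \<in> M" using pairingD(1)[OF D_D(1)[OF pd] j(1)] in_M[OF j(1)] j(2) by blast
qed

lemma arc_ends_gblock:
  assumes "(p, d) \<in> D" "j < 3" "f \<in> A j"
  shows "arc_ends g (gblock p d ` M) f = {merged p d, merged p (flip p d)} \<longleftrightarrow> f \<in> {d j, p (d j)}"
proof
  note D = D_D[OF assms(1)]
  have f: "f \<in> M" "g f \<in> A j" "g f \<in> M" using in_M g_mem assms by auto
  have ends: "arc_ends g (gblock p d ` M) f = {gblock p d (g f), gblock p d f}"
    using block_of_gblock[OF assms(1)] f by (simp add: arc_ends_def)
  {
    assume "arc_ends g (gblock p d ` M) f = {merged p d, merged p (flip p d)}"
    \<comment> \<open>Traces on \<open>A j\<close> turn the glued blocks back into vertices of the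
      tree, where \<open>kb_ends_iff\<close> applies.\<close>
    then have "(\<lambda>B. B \<inter> A j) ` {gblock p d (g f), gblock p d f} =
        (\<lambda>B. B \<inter> A j) ` {merged p d, merged p (flip p d)}" using ends by simp
    then have "{kb p (p f), kb p f} = {kb p (d j), kb p (p (d j))}"
      using gblock_Int[OF assms] gblock_Int[OF assms(1,2) f(2)] merged_Int[OF assms(1,2)]
        merged_Int[OF flip_in_D[OF assms(1)] assms(2)] kb_g[OF D(1) assms(2,3)]
      by (simp add: flip_apply[OF assms(2)])
    then show "f \<in> {d j, p (d j)}"
      using kb_ends_iff[OF D(1) assms(2,3) D(3)[OF assms(2)]] by (simp only: insert_commute)
  }
  have mem: "gblock p d x = merged p d'" if "(p, d') \<in> D" "d' = d \<or> d' = flip p d"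
    "x \<in> A j" "kb p x = kb p (d' j)" for x d'
  proof -
    have "x \<in> merged p d'"
      using kb_self[of x p] in_M[OF assms(2) that(3)] that(4) assms(2) unfolding merged_def by blast
    then show ?thesis using that(2) merged_disjoint[OF assms(1)] by (auto simp: gblock_def)
  qed
  note D1 = assms(1) and D2 = flip_in_D[OF assms(1)]
  have pd: "p (p (d j)) = d j" using pairingD[OF D(1) assms(2)] D assms by blast
  have kbg: "kb p (g f) = kb p (p f)" by (rule kb_g[OF D(1) assms(2,3)])
  assume "f \<in> {d j, p (d j)}"
  then show "arc_ends g (gblock p d ` M) f = {merged p d, merged p (flip p d)}"
    unfolding ends
    using mem[OF D1 _ assms(3)] mem[OF D2 _ assms(3)] mem[OF D1 _ f(2)] mem[OF D2 _ f(2)] pd kbg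
    by (auto simp: flip_apply[OF assms(2)])
qed

text \<open>The arcs of the common edge are exactly those whose ends are the two glued blocks;
  \<open>d 0\<close> is one representative.\<close>

lemma arc_class_common_edge:
  assumes "(p, d) \<in> D"
  shows "arc_class M g (gblock p d ` M) (d 0) = common_edge p d"
proof -
  note D = D_D[OF assms]
  have 0: "arc_ends g (gblock p d ` M) (d 0) = {merged p d, merged p (flip p d)}"
    using arc_ends_gblock[OF assms, of 0 "d 0"] D(3)[of 0] by simp
  show ?thesis
  proof (rule set_eqI)
    fix f
    show "f \<in> arc_class M g (gblock p d ` M) (d 0) \<longleftrightarrow> f \<in> common_edge p d"
    proof (cases "f \<in> M")
      case True
      then obtain j where j: "j < 3" "f \<in> A j" by (rule M_E)
      then show ?thesis
        using arc_ends_gblock[OF assms j] common_edge_Int[OF assms j(1)] True 0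
        unfolding arc_class_def by auto
    next
      case False
      then show ?thesis using common_edge_subset[OF assms] unfolding arc_class_def by auto
    qed
  qed
qed

lemma card_common_edge:
  assumes "(p, d) \<in> D"
  shows "card (common_edge p d) = 6"
proof -
  note D = D_D[OF assms]
  have sub: "{d i, p (d i)} \<subseteq> A i" if "i < 3" for i
    using pairingD(1)[OF D(1) that D(3)[OF that]] D(3)[OF that] by blast
  have "{d i, p (d i)} \<inter> {d j, p (d j)} = {}" if "i < 3" "j < 3" "i \<noteq> j" for i j
    using sub[OF that(1)] sub[OF that(2)] A_unique[OF that(1,2)] that(3) by blast
  then have *: "card (common_edge p d) = (\<Sum>j<3. card {d j, p (d j)})"
    unfolding common_edge_def by (intro card_UN_disjoint ballI impI) simp_all
  have "card {d j, p (d j)} = 2" if "j < 3" for j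
    using pairingD(2)[OF D(1) that D(3)[OF that]] by (simp add: card_insert_if)
  then have "(\<Sum>j<3. card {d j, p (d j)}) = (\<Sum>j<(3::nat). 2)" by (intro sum.cong) auto
  with * show ?thesis by simp
qed

section \<open>Partitions of 2-6 tree type\<close>

definition tree_type :: "nat set set \<Rightarrow> bool" where
  "tree_type P \<longleftrightarrow>
     (\<forall>j<3. double_tree (quot (A j) g (restrict_partition P (A j)))) \<and>
     (\<exists>C \<in> uedges (elementarization (quot M g P)). card C = 6 \<and>
        (\<forall>j<3. C \<inter> A j \<in> uedges (elementarization (quot (A j) g (restrict_partition P (A j))))) \<and>
        (\<forall>B \<in> P - uends (elementarization (quot M g P)) C. \<exists>j<3. B \<subseteq> A j))"

lemma tree_type_gblock:
  assumes "(p, d) \<in> D"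
  shows "tree_type (gblock p d ` M)"
  unfolding tree_type_def
proof (intro conjI allI impI bexI[of _ "common_edge p d"] ballI)
  note D = D_D[OF assms]
  let ?P = "gblock p d ` M"
  have d0: "d 0 \<in> M" using D(3)[of 0] in_M[of 0] by simp
  have ac: "common_edge p d = arc_class M g ?P (d 0)" using arc_class_common_edge[OF assms] by simp
  show "common_edge p d \<in> uedges (elementarization (quot M g ?P))"
    unfolding uedges_quot ac using d0 by (rule imageI)
  fix j :: nat assume j: "j < 3"
  show "double_tree (quot (A j) g (restrict_partition ?P (A j)))"
    unfolding restrict_partition_gblock[OF assms j] using double_tree_kb[OF D(1) j] D(3)[OF j] by blast
  show "common_edge p d \<inter> A j \<in> uedges (elementarization (quot (A j) g (restrict_partition ?P (A j))))"
    unfolding restrict_partition_gblock[OF assms j] uedges_quot common_edge_Int[OF assms j]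
      arc_class_kb[OF D(1) j D(3)[OF j], symmetric] using D(3)[OF j] by (rule imageI)
next
  note D = D_D[OF assms]
  let ?P = "gblock p d ` M"
  have d0: "d 0 \<in> M" using D(3)[of 0] in_M[of 0] by simp
  fix B assume B: "B \<in> ?P - uends (elementarization (quot M g ?P)) (common_edge p d)"
  have "uends (elementarization (quot M g ?P)) (common_edge p d) = {merged p d, merged p (flip p d)}"
    unfolding arc_class_common_edge[OF assms, symmetric] uends_quot[OF d0]
    using arc_ends_gblock[OF assms, of 0 "d 0"] D(3)[of 0] by simp
  with B obtain x where "x \<in> M" "B = kb p x" by (auto simp: gblock_def split: if_splits)
  then show "\<exists>j<3. B \<subseteq> A j" using kb_subset by (blast elim: M_E)
qed (rule card_common_edge[OF assms])

lemma restrict_partition_Int: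
  assumes "partition_on M P" "j < 3" "restrict_partition P (A j) = kb p ` A j" "x \<in> A j"
  shows "block_of P x \<inter> A j = kb p x"
proof -
  have x: "x \<in> M" "block_of P x \<in> P" "x \<in> block_of P x"
    using block_of_mem[OF assms(1)] in_M assms(2,4) by auto
  then have "block_of P x \<inter> A j \<in> restrict_partition P (A j)"
    using assms(4) unfolding restrict_partition_def by blast
  then obtain y where y: "y \<in> A j" "block_of P x \<inter> A j = kb p y" unfolding assms(3) by blast
  moreover have "kb p x = kb p y" using kb_eq_if_mem[of y x p] y in_M[OF assms(2)] x assms(4) by blast
  ultimately show ?thesis by simp
qed

text \<open>The trees provide \<open>p\<close>. The two ends \<open>U\<close> and \<open>W\<close>
  of the common edge then orient it, and \<open>d j\<close> is the arc of the edge in the cycle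
  \<open>j\<close> whose head is in \<open>U\<close>.\<close>

lemma tree_type_obtains_gblock:
  assumes P: "partition_on M P" and T: "tree_type P"
  obtains p d where "(p, d) \<in> D" "P = gblock p d ` M"
proof -
  have rp: "partition_on (A j) (restrict_partition P (A j))" if "j < 3" for j
  proof -
    have "A j \<inter> M = A j" using A_subset_M that by blast
    moreover have "(\<inter>) (A j) ` P - {{}} = restrict_partition P (A j)"
      unfolding restrict_partition_def by blast
    ultimately show ?thesis using partition_on_restrict[OF P, of "A j"] by simp
  qed
  obtain p where p: "pairing p" "\<And>x. x \<notin> M \<Longrightarrow> p x = x"
    and r: "\<And>j. j < 3 \<Longrightarrow> restrict_partition P (A j) = kb p ` A j"
    using double_trees_obtain_pairing[of "\<lambda>j. restrict_partition P (A j)"] rp T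
    unfolding tree_type_def by blast
  note D = pairingD[OF p(1)]
  let ?b = "block_of P"
  note mem = block_of_mem[OF P] and int = restrict_partition_Int[OF P _ r]
  obtain C where C: "C \<in> uedges (elementarization (quot M g P))"
    and CA: "\<And>j. j < 3 \<Longrightarrow> C \<inter> A j \<in> uedges (elementarization (quot (A j) g (kb p ` A j)))"
    and local: "\<And>B. B \<in> P \<Longrightarrow> B \<notin> uends (elementarization (quot M g P)) C \<Longrightarrow> \<exists>j<3. B \<subseteq> A j"
    using T r unfolding tree_type_def by auto
  obtain e where e: "e \<in> M" "C = arc_class M g P e" using C unfolding uedges_quot by blast
  have uends: "uends (elementarization (quot M g P)) C = arc_ends g P e"
    unfolding e(2) using e(1) by (rule uends_quot)
  define U where "U = ?b e"
  define W where "W = ?b (g e)"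
  have UW: "arc_ends g P e = {U, W}" by (auto simp: arc_ends_def U_def W_def)
  \<comment> \<open>The common edge contains two opposite arcs of each cycle, so exactly one choice
    between \<open>a\<close> and \<open>p a\<close> respects the orientation.\<close>
  have "\<exists>x \<in> A j. ?b x = U \<and> ?b (p x) = W" if j: "j < 3" for j
  proof -
    obtain a where a: "a \<in> A j" "C \<inter> A j = {a, p a}"
      using CA[OF j] arc_class_kb[OF p(1) j] unfolding uedges_quot by auto
    then have "arc_ends g P a = {U, W}" using e(2) UW unfolding arc_class_def by blast
    \<comment> \<open>In the tree the two vertices agree; hence the blocks of \<open>P\<close> share
      the point \<open>p a\<close>.\<close>
    moreover have "?b (g a) = ?b (p a)"
    proof -
      have "p a \<in> A j" "g a \<in> A j" using D g_mem j a by auto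
      moreover have "kb p (g a) = kb p (p a)" using kb_g p j a by blast
      ultimately have "?b (g a) \<inter> A j = ?b (p a) \<inter> A j" "p a \<in> ?b (p a) \<inter> A j"
        using int[OF j j] kb_self[OF in_M[OF j], of "p a"] mem(2)[OF in_M[OF j], of "p a"] by auto
      then have "p a \<in> ?b (g a)" by blast
      then show ?thesis using block_of_eq[OF P mem(1)[OF in_M[OF j \<open>g a \<in> A j\<close>]]] by simp
    qed
    ultimately have "?b a = U \<and> ?b (p a) = W \<or> ?b a = W \<and> ?b (p a) = U"
      unfolding arc_ends_def doubleton_eq_iff by auto
    then show ?thesis using a(1) D[OF j a(1)] by metis
  qed
  then obtain d0 where d0: "\<And>j. j < 3 \<Longrightarrow> d0 j \<in> A j \<and> ?b (d0 j) = U \<and> ?b (p (d0 j)) = W" by metis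
  define d where "d = (\<lambda>j \<in> {..<3}. d0 j)"
  have d: "d j \<in> A j" "?b (d j) = U" "?b (p (d j)) = W" if "j < 3" for j
    using d0[OF that] that by (auto simp: d_def)
  have pd: "(p, d) \<in> D" using p d(1) by (auto simp: D_def S_def d_def)
  have "e \<in> M" "g e \<in> M" using e g_mem in_M by (auto elim!: M_E)
  then have UWP: "U \<in> P" "W \<in> P" using mem by (auto simp: U_def W_def)
  then have sub: "U \<subseteq> M" "W \<subseteq> M" using P by (auto simp: partition_on_def)
  \<comment> \<open>\<open>U\<close> and \<open>W\<close> contain \<open>d j\<close> and
    \<open>p (d j)\<close>, so their traces are the classes of these points, as are those of the
    glued blocks. A subset of \<open>M\<close> is determined by its three traces.\<close>
  have UWj: "U \<inter> A j = merged p d \<inter> A j" "W \<inter> A j = merged p (flip p d) \<inter> A j" if j: "j < 3" for j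
    using int[OF j j d(1)[OF j]] int[OF j j D(1)[OF j d(1)[OF j]]] d(2,3)[OF j]
      merged_Int[OF pd j] merged_Int[OF flip_in_D[OF pd] j] by (auto simp: flip_apply[OF j])
  have UW': "U = merged p d" "W = merged p (flip p d)"
    using eq_if_Int_A_eq[OF sub(1) merged_subset[OF pd] UWj(1)]
      eq_if_Int_A_eq[OF sub(2) merged_subset[OF flip_in_D[OF pd]] UWj(2)] by simp_all
  have "?b x = gblock p d x" if x: "x \<in> M" for x
  proof -
    consider "x \<in> U" | "x \<in> W" "x \<notin> U" | "x \<notin> U" "x \<notin> W" by blast
    then show ?thesis
    proof cases
      case 1
      then show ?thesis using block_of_eq[OF P UWP(1)] UW' by (simp add: gblock_def)
    next
      case 2
      then show ?thesis using block_of_eq[OF P UWP(2)] UW' by (simp add: gblock_def)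
    next
      case 3
      \<comment> \<open>Here it enters that only the ends of the common edge are identified between
        different trees.\<close>
      then have "?b x \<notin> {U, W}" using mem(2)[OF x] by auto
      then obtain i where i: "i < 3" "?b x \<subseteq> A i" using local mem(1)[OF x] uends UW by blast
      then have "x \<in> A i" using mem(2)[OF x] by blast
      then have "?b x = kb p x" using int[OF i(1) i(1)] i(2) by blast
      then show ?thesis using 3 UW' by (simp add: gblock_def)
    qed
  qed
  then have "P = gblock p d ` M" using block_of_image_eq[OF P] by (metis (no_types, lifting) image_cong)
  with pd show thesis by (rule that)
qed

text \<open>The traces on the cycles determine \<open>p\<close>. The two glued blocks are the only
  blocks not contained in a single cycle, so they are known up to order, and the order is that of
  heads and tails.\<close>

lemma gblock_image_eq_iff:
  assumes "(p, d) \<in> D" "(p', d') \<in> D"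
  shows "gblock p d ` M = gblock p' d' ` M \<longleftrightarrow> p' = p \<and> d' \<in> {d, flip p d}"
proof
  assume eq: "gblock p d ` M = gblock p' d' ` M"
  note D = D_D[OF assms(1)] and D' = D_D[OF assms(2)]
  have kbs: "kb p ` A j = kb p' ` A j" if "j < 3" for j
    using restrict_partition_gblock[OF assms(1) that] restrict_partition_gblock[OF assms(2) that] eq by simp
  have p: "p' = p"
  proof
    fix x show "p' x = p x"
    proof (cases "x \<in> M")
      case True
      then obtain j where "j < 3" "x \<in> A j" by (rule M_E)
      then show ?thesis using pairing_eq_if_kb_images_eq[OF D(1) D'(1) _ kbs] by simp
    qed (use D(2) D'(2) in simp)
  qed
  have nonlocal: "{merged p d, merged p (flip p d)} = {B \<in> gblock p d ` M. \<forall>j<3. \<not> B \<subseteq> A j}"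
    if pd: "(p, d) \<in> D" for d
  proof
    have "merged p d \<in> gblock p d ` M" if pd: "(p, d) \<in> D" for d
    proof -
      have "d 0 \<in> M" "d 0 \<in> merged p d"
        using D_D(3)[OF pd, of 0] in_M[of 0] kb_self[of "d 0" p] by (auto simp: merged_def)
      then show ?thesis by (auto simp: gblock_def image_iff intro!: bexI[of _ "d 0"])
    qed
    from this[OF pd] this[OF flip_in_D[OF pd]]
    show "{merged p d, merged p (flip p d)} \<subseteq> {B \<in> gblock p d ` M. \<forall>j<3. \<not> B \<subseteq> A j}"
      using merged_not_subset[OF pd] merged_not_subset[OF flip_in_D[OF pd]] gblock_flip[OF pd] by simp
    show "{B \<in> gblock p d ` M. \<forall>j<3. \<not> B \<subseteq> A j} \<subseteq> {merged p d, merged p (flip p d)}"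
    proof
      fix B assume "B \<in> {B \<in> gblock p d ` M. \<forall>j<3. \<not> B \<subseteq> A j}"
      then obtain x where x: "x \<in> M" "B = gblock p d x" "\<forall>j<3. \<not> B \<subseteq> A j" by blast
      then obtain j where "j < 3" "x \<in> A j" by (blast elim: M_E)
      then have "B \<noteq> kb p x" using kb_subset x(3) by blast
      then show "B \<in> {merged p d, merged p (flip p d)}"
        using x(2) unfolding gblock_def by (simp split: if_splits)
    qed
  qed
  have mm: "{merged p d, merged p (flip p d)} = {merged p d', merged p (flip p d')}"
    using nonlocal[OF assms(1)] nonlocal[of d'] assms(2) eq p by simp
  \<comment> \<open>Traces of the ordered glued blocks give the head and the tail of each arc, hence
    the arc.\<close>
  have d_eq: "d1 = d2" if d1: "(p, d1) \<in> D" and d2: "(p, d2) \<in> D"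
    and m: "merged p d1 = merged p d2" "merged p (flip p d1) = merged p (flip p d2)" for d1 d2
  proof
    fix j show "d1 j = d2 j"
    proof (cases "j < 3")
      case True
      have "kb p (d1 j) = kb p (d2 j)" "kb p (p (d1 j)) = kb p (p (d2 j))"
        using merged_Int[OF d1 True] merged_Int[OF d2 True] m
          merged_Int[OF flip_in_D[OF d1] True] merged_Int[OF flip_in_D[OF d2] True]
        by (simp_all add: flip_apply[OF True])
      then show ?thesis using kb_inject[OF D(1) True] D_D(3)[OF d1 True] D_D(3)[OF d2 True] by blast
    qed (use D_D(4)[OF d1] D_D(4)[OF d2] in simp)
  qed
  have d': "(p, d') \<in> D" using assms(2) p by simp
  have "d' = d \<or> d' = flip p d"
    using mm d_eq[OF d' assms(1)] d_eq[OF d' flip_in_D[OF assms(1)]] flip_flip[OF assms(1)]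
    unfolding doubleton_eq_iff by auto
  with p show "p' = p \<and> d' \<in> {d, flip p d}" by simp
next
  assume "p' = p \<and> d' \<in> {d, flip p d}"
  then show "gblock p d ` M = gblock p' d' ` M" using gblock_flip[OF assms(1)] by auto
qed

lemma pairing_permutes: "p \<in> S \<Longrightarrow> p permutes M"
  using pairingD(1,3) in_M
  by (intro bij_imp_permutes bij_betwI[of _ _ _ p]) (auto simp: S_def Pi_def elim!: M_E)

lemma finite_D: "finite D"
proof -
  have "finite S"
    using finite_permutations[OF finite_M] by (rule finite_subset[rotated]) (auto intro: pairing_permutes)
  then show ?thesis unfolding D_def by (auto intro!: finite_PiE simp: A_def)
qed

lemma card_D_eq_card_tree_type: "card D = 2 * card {P. partition_on M P \<and> tree_type P}"
proof -
  let ?G = "\<lambda>(p, d). gblock p d ` M"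
  have "card D = 2 * card (?G ` D)"
  proof (rule card_eq_mult_card_image[OF finite_D])
    fix x assume "x \<in> D"
    then obtain p d where pd: "x = (p, d)" "(p, d) \<in> D" by (cases x) auto
    have "?G y = ?G x \<longleftrightarrow> y \<in> {(p, d), (p, flip p d)}" if "y \<in> D" for y
    proof (cases y)
      case (Pair p' d')
      then show ?thesis
        using gblock_image_eq_iff[OF pd(2), of p' d'] that
        unfolding pd(1) Pair prod.case by (simp add: eq_commute[of "gblock p d ` M"]) blast
    qed
    then have "{y \<in> D. ?G y = ?G x} = {y \<in> D. y \<in> {(p, d), (p, flip p d)}}"
      by (intro Collect_cong conj_cong refl)
    also have "\<dots> = {(p, d), (p, flip p d)}" using flip_in_D[OF pd(2)] pd(2) by blast
    finally have "{y \<in> D. ?G y = ?G x} = {(p, d), (p, flip p d)}" .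
    moreover have "d 0 \<noteq> flip p d 0"
      using pairingD(2)[of p 0 "d 0"] D_D[OF pd(2)] by (simp add: flip_apply)
    then have "d \<noteq> flip p d" by metis
    ultimately show "card {y \<in> D. ?G y = ?G x} = 2" by simp
  qed
  also have "?G ` D = {P. partition_on M P \<and> tree_type P}"
  proof
    show "?G ` D \<subseteq> {P. partition_on M P \<and> tree_type P}"
      using partition_on_gblock tree_type_gblock by auto
    show "{P. partition_on M P \<and> tree_type P} \<subseteq> ?G ` D"
    proof
      fix P assume "P \<in> {P. partition_on M P \<and> tree_type P}"
      then obtain p d where "(p, d) \<in> D" "P = gblock p d ` M"
        using tree_type_obtains_gblock by blast
      then show "P \<in> ?G ` D" by (intro image_eqI[of _ _ "(p, d)"]) simp
    qed
  qed
  finally show ?thesis .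
qed

section \<open>Partitioned permutations\<close>

lemma pblock_self: "x \<in> pblock p d x"
  by (simp add: pblock_def)

lemma common_edge_closed:
  assumes "(p, d) \<in> D" "x \<in> common_edge p d"
  shows "p x \<in> common_edge p d"
proof -
  obtain j where j: "j < 3" "x \<in> {d j, p (d j)}" using assms(2) by (auto simp: common_edge_def)
  then have "p x \<in> {d j, p (d j)}" using pairingD(3)[OF D_D(1)[OF assms(1)] j(1)] D_D(3)[OF assms(1)] by auto
  then show ?thesis using j(1) unfolding common_edge_def by blast
qed

lemma partition_on_pblock:
  assumes "(p, d) \<in> D"
  shows "partition_on M (pblock p d ` M)"
proof (rule partition_on_image)
  fix x assume x: "x \<in> M"
  then obtain j where j: "j < 3" "x \<in> A j" by (rule M_E)
  note P = pairingD[OF D_D(1)[OF assms] j]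
  have px: "p x \<in> M" using P(1) in_M j(1) by blast
  show "pblock p d x \<subseteq> M"
    using common_edge_subset[OF assms] x px by (simp add: pblock_def)
  fix y assume y: "y \<in> pblock p d x"
  show "pblock p d y = pblock p d x"
  proof (cases "x \<in> common_edge p d")
    case True
    then show ?thesis using y by (simp add: pblock_def)
  next
    case False
    then have "y = x \<or> y = p x" using y by (simp add: pblock_def)
    then show ?thesis
    proof
      assume y: "y = p x"
      have "p x \<notin> common_edge p d" using common_edge_closed[OF assms, of "p x"] False P(3) by auto
      then show ?thesis unfolding y using False P(3) by (simp add: pblock_def insert_commute)
    qed simp
  qed
qed (rule pblock_self)

lemma common_edge_not_subset:
  assumes "(p, d) \<in> D" "j < 3"
  shows "\<not> common_edge p d \<subseteq> A j"
proof
  assume sub: "common_edge p d \<subseteq> A j"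
  define i :: nat where "i = (if j = 0 then 1 else 0)"
  have i: "i < 3" "i \<noteq> j" by (auto simp: i_def)
  have "d i \<in> A i" using D_D(3)[OF assms(1) i(1)] .
  moreover have "d i \<in> common_edge p d" using i(1) unfolding common_edge_def by blast
  ultimately show False using sub A_unique assms(2) i by blast
qed

lemma common_edge_in_pblock:
  assumes "(p, d) \<in> D"
  shows "common_edge p d \<in> pblock p d ` M"
proof -
  have "d 0 \<in> common_edge p d" by (auto simp: common_edge_def)
  then have "d 0 \<in> M" "pblock p d (d 0) = common_edge p d"
    using common_edge_subset[OF assms] by (auto simp: pblock_def)
  then show ?thesis by (metis imageI)
qed

text \<open>The large block is recognizable as the only one not contained in a single cycle. Its
  traces give the three pairs, but not which point of a pair was chosen.\<close>

lemma pblock_image_eq_iff: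
  assumes "(p, d) \<in> D" "(p, d') \<in> D"
  shows "pblock p d ` M = pblock p d' ` M \<longleftrightarrow> (\<forall>j<3. d' j \<in> {d j, p (d j)})"
proof
  assume eq: "pblock p d ` M = pblock p d' ` M"
  have "common_edge p d' \<in> pblock p d ` M"
    using common_edge_in_pblock[OF assms(2)] unfolding eq .
  then obtain x where x: "x \<in> M" "common_edge p d' = pblock p d x" by (rule imageE)
  obtain j where j: "j < 3" "x \<in> A j" using x(1) by (rule M_E)
  have "{x, p x} \<subseteq> A j" using pairingD(1)[OF D_D(1)[OF assms(1)] j] j(2) by blast
  then have C: "common_edge p d' = common_edge p d"
    using common_edge_not_subset[OF assms(2) j(1)] x(2) unfolding pblock_def
    by (cases "x \<in> common_edge p d") simp_all
  show "\<forall>j<3. d' j \<in> {d j, p (d j)}"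
  proof (intro allI impI)
    fix j :: nat assume "j < 3"
    then have "{d j, p (d j)} = {d' j, p (d' j)}"
      using common_edge_Int[OF assms(1)] common_edge_Int[OF assms(2)] C by simp
    then show "d' j \<in> {d j, p (d j)}" by simp
  qed
next
  assume d': "\<forall>j<3. d' j \<in> {d j, p (d j)}"
  have "{d j, p (d j)} = {d' j, p (d' j)}" if "j < 3" for j
    using d' that pairingD(3)[OF D_D(1)[OF assms(1)] that D_D(3)[OF assms(1) that]] by auto
  then have "common_edge p d = common_edge p d'" unfolding common_edge_def by (intro SUP_cong) auto
  then show "pblock p d ` M = pblock p d' ` M" by (simp add: pblock_def)
qed

lemma card_D_eq_card_pblock: "card D = 8 * card ((\<lambda>(p, d). (pblock p d ` M, p)) ` D)"
proof (rule card_eq_mult_card_image[OF finite_D])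
  let ?F = "\<lambda>(p, d). (pblock p d ` M, p)"
  fix x assume "x \<in> D"
  then obtain p d where pd: "x = (p, d)" "(p, d) \<in> D" by (cases x) auto
  note P = pairingD[OF D_D(1)[OF pd(2)] _ D_D(3)[OF pd(2)]]
  \<comment> \<open>The fibre consists of the independent choices of one point from each of three
    pairs, whence \<open>2 ^ 3 = 8\<close>.\<close>
  let ?E = "PiE {..<3} (\<lambda>j. {d j, p (d j)})"
  have E: "d' \<in> ?E \<longleftrightarrow> (\<forall>j<3. d' j \<in> {d j, p (d j)})" if "(p, d') \<in> D" for d'
    using D_D(4)[OF that] by (auto simp: PiE_iff extensional_def)
  have E_D: "(p, d') \<in> D" if "d' \<in> ?E" for d'
  proof -
    have "d' j \<in> A j" if "j < 3" for j
    proof -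
      have "d' j \<in> {d j, p (d j)}" using PiE_mem[OF \<open>d' \<in> ?E\<close>, of j] that by simp
      then show ?thesis using P(1)[OF that that] D_D(3)[OF pd(2) that] by auto
    qed
    then show ?thesis using \<open>d' \<in> ?E\<close> pd(2) by (auto simp: D_def PiE_iff)
  qed
  have "?F y = ?F x \<longleftrightarrow> y \<in> {p} \<times> ?E" if "y \<in> D" for y
  proof (cases y)
    case (Pair p' d')
    show ?thesis
    proof (cases "p' = p")
      case True
      then have "(p, d') \<in> D" using that Pair by simp
      then show ?thesis using pblock_image_eq_iff[OF pd(2), of d'] E[of d']
        unfolding Pair pd(1) prod.case True by (simp add: eq_commute[of "pblock p d ` M"])
    qed (simp add: Pair pd(1))
  qed
  then have "{y \<in> D. ?F y = ?F x} = {y \<in> D. y \<in> {p} \<times> ?E}"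
    by (intro Collect_cong conj_cong refl)
  also have "\<dots> = {p} \<times> ?E" using E_D by blast
  finally have "{y \<in> D. ?F y = ?F x} = {p} \<times> ?E" .
  moreover have "card ({p} \<times> ?E) = (\<Prod>j<3. card {d j, p (d j)})"
    by (simp add: card_cartesian_product card_PiE)
  moreover have "card {d j, p (d j)} = 2" if "j < 3" for j
    using P(2)[OF that that] by (simp add: card_insert_if)
  then have "(\<Prod>j<3. card {d j, p (d j)}) = (\<Prod>j<(3::nat). 2)" by (intro prod.cong) auto
  ultimately show "card {y \<in> D. ?F y = ?F x} = 8" by simp
qed

lemma pairing_iff:
  "pairing p \<longleftrightarrow> (\<forall>j<3. (\<forall>x \<in> A j. p x \<in> A j \<and> p x \<noteq> x \<and> p (p x) = x) \<and>
     \<not> (\<exists>a \<in> A j. \<exists>b \<in> A j. \<exists>c \<in> A j. \<exists>d \<in> A j. a < b \<and> b < c \<and> c < d \<and> p a = c \<and> p b = d))"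
  unfolding pairing_def A_def using interval_cycle.nc_pairing_def[OF cycle] by simp

definition pperms :: "(nat set set \<times> (nat \<Rightarrow> nat)) set" where
  "pperms = {(V, p). \<exists>p1 \<in> NC2 (A 0). \<exists>p2 \<in> NC2 (A 1). \<exists>p3 \<in> NC2 (A 2).
     p = p1 \<circ> p2 \<circ> p3 \<and> partition_on M V \<and>
     (\<exists>c1 \<in> perm_cycles p1 (A 0). \<exists>c2 \<in> perm_cycles p2 (A 1). \<exists>c3 \<in> perm_cycles p3 (A 2).
        c1 \<union> c2 \<union> c3 \<in> V \<and> (\<forall>B \<in> V - {c1 \<union> c2 \<union> c3}. B \<in> perm_cycles p M))}"

lemma common_edge_eq: "common_edge p d = {d 0, p (d 0)} \<union> {d 1, p (d 1)} \<union> {d 2, p (d 2)}"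
  unfolding common_edge_def by (auto simp: less_3_cases lessThan_def)

lemma restrict_in_NC2:
  assumes "pairing p" "j < 3"
  shows "(\<lambda>x. if x \<in> A j then p x else x) \<in> NC2 (A j)"
proof -
  note D = pairingD[OF assms]
  let ?q = "\<lambda>x. if x \<in> A j then p x else x"
  have "?q permutes A j"
    using D(1,3) by (intro bij_imp_permutes bij_betwI[of _ _ _ ?q]) auto
  moreover have "\<not> (\<exists>a \<in> A j. \<exists>b \<in> A j. \<exists>c \<in> A j. \<exists>d \<in> A j.
      a < b \<and> b < c \<and> c < d \<and> ?q a = c \<and> ?q b = d)"
    using assms unfolding pairing_iff by auto
  ultimately show ?thesis using D unfolding NC2_def by auto
qed

lemma pperms_eq: "pperms = (\<lambda>(p, d). (pblock p d ` M, p)) ` D"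
proof
  show "(\<lambda>(p, d). (pblock p d ` M, p)) ` D \<subseteq> pperms"
  proof
    fix x assume "x \<in> (\<lambda>(p, d). (pblock p d ` M, p)) ` D"
    then obtain p d where pd: "(p, d) \<in> D" and x: "x = (pblock p d ` M, p)" by auto
    note P = D_D[OF pd] and I = pairingD[OF D_D(1)[OF pd]]
    \<comment> \<open>The factors of \<open>p\<close> are its restrictions, extended by the
      identity; their supports are disjoint.\<close>
    define q where "q j = (\<lambda>x. if x \<in> A j then p x else x)" for j
    have q: "q j \<in> NC2 (A j)" if "j < 3" for j
      unfolding q_def by (rule restrict_in_NC2[OF P(1) that])
    have "p x = (q 0 \<circ> q 1 \<circ> q 2) x" for x
    proof (cases "x \<in> M")
      case True
      then obtain j where j: "j < 3" "x \<in> A j" by (rule M_E)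
      have notin: "x \<notin> A i" "p x \<notin> A i" if "i < 3" "i \<noteq> j" for i
        using A_unique[OF that(1) j(1)] that I(1)[OF j] j(2) by blast+
      from j(1) have "j = 0 \<or> j = 1 \<or> j = 2" by (simp only: less_3_cases)
      then show ?thesis
        using notin[of 0] notin[of 1] notin[of 2] j(2) I(1)[OF j] unfolding q_def
        by (elim disjE) simp_all
    next
      case False
      then have "x \<notin> A j" if "j < 3" for j using in_M that by blast
      then show ?thesis using P(2)[OF False] by (auto simp: q_def)
    qed
    then have p: "p = q 0 \<circ> q 1 \<circ> q 2" by blast
    have c: "{d j, p (d j)} \<in> perm_cycles (q j) (A j)" if "j < 3" for j
    proof -
      have "q j (q j (d j)) = d j" "q j (d j) = p (d j)" using I[OF that P(3)[OF that]] P(3)[OF that]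
        by (auto simp: q_def)
      then have "orbit (q j) (d j) = {d j, p (d j)}" using orbit_involution by metis
      then show ?thesis using P(3)[OF that] unfolding perm_cycles_def by blast
    qed
    have "B \<in> perm_cycles p M" if B: "B \<in> pblock p d ` M - {common_edge p d}" for B
    proof -
      obtain x where x: "x \<in> M" "B = {x, p x}" using B by (auto simp: pblock_def split: if_splits)
      then have "p (p x) = x" using I(3) by (blast elim: M_E)
      then have "B = orbit p x" using x(2) orbit_involution by metis
      then show ?thesis using x(1) unfolding perm_cycles_def by blast
    qed
    then have "\<forall>B \<in> pblock p d ` M - {{d 0, p (d 0)} \<union> {d 1, p (d 1)} \<union> {d 2, p (d 2)}}.
        B \<in> perm_cycles p M" unfolding common_edge_eq by blast
    moreover have "{d 0, p (d 0)} \<union> {d 1, p (d 1)} \<union> {d 2, p (d 2)} \<in> pblock p d ` M"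
      using common_edge_in_pblock[OF pd] unfolding common_edge_eq .
    ultimately have "\<exists>c1 \<in> perm_cycles (q 0) (A 0). \<exists>c2 \<in> perm_cycles (q 1) (A 1).
        \<exists>c3 \<in> perm_cycles (q 2) (A 2). c1 \<union> c2 \<union> c3 \<in> pblock p d ` M \<and>
        (\<forall>B \<in> pblock p d ` M - {c1 \<union> c2 \<union> c3}. B \<in> perm_cycles p M)"
      using c[of 0] c[of 1] c[of 2]
      by (intro bexI[of _ "{d 0, p (d 0)}"] bexI[of _ "{d 1, p (d 1)}"] bexI[of _ "{d 2, p (d 2)}"] conjI)
        simp_all
    then show "x \<in> pperms"
      unfolding x pperms_def mem_Collect_eq prod.case
      using q[of 0] q[of 1] q[of 2] p partition_on_pblock[OF pd]
      by (intro bexI[of _ "q 0"] bexI[of _ "q 1"] bexI[of _ "q 2"] conjI) simp_all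
  qed
  show "pperms \<subseteq> (\<lambda>(p, d). (pblock p d ` M, p)) ` D"
  proof
    fix y assume y: "y \<in> pperms"
    obtain V p where Vp: "y = (V, p)" by (cases y)
    obtain p1 p2 p3 c1 c2 c3 where
      q: "p1 \<in> NC2 (A 0)" "p2 \<in> NC2 (A 1)" "p3 \<in> NC2 (A 2)" and
      p: "p = p1 \<circ> p2 \<circ> p3" and V: "partition_on M V" and
      cs: "c1 \<in> perm_cycles p1 (A 0)" "c2 \<in> perm_cycles p2 (A 1)" "c3 \<in> perm_cycles p3 (A 2)" and
      CV: "c1 \<union> c2 \<union> c3 \<in> V" and other: "\<forall>B \<in> V - {c1 \<union> c2 \<union> c3}. B \<in> perm_cycles p M"
      using y unfolding Vp pperms_def by blast
    define q where "q j = (if j = 0 then p1 else if j = 1 then p2 else p3)" for j :: nat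
    have Q: "q j \<in> NC2 (A j)" if "j < 3" for j
      using that q unfolding less_3_cases by (auto simp: q_def)
    have off: "q j x = x" if "j < 3" "x \<notin> A j" for j x
      using Q[OF that(1)] that(2) by (auto simp: NC2_def permutes_def)
    have inv: "q j x \<in> A j" "q j x \<noteq> x" "q j (q j x) = x" if "j < 3" "x \<in> A j" for j x
      using Q[OF that(1)] that(2) by (auto simp: NC2_def permutes_in_image)
    have p': "p x = q 0 (q 1 (q 2 x))" for x by (simp add: p q_def)
    \<comment> \<open>The other two factors fix both \<open>x\<close> and
      \<open>q j x\<close>.\<close>
    have on: "p x = q j x" if j: "j < 3" "x \<in> A j" for j x
    proof -
      have "x \<notin> A i" "q j x \<notin> A i" if "i < 3" "i \<noteq> j" for i
        using A_unique[OF that(1) j(1)] that inv(1)[OF j] j(2) by blast+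
      then have fixed: "q i x = x" "q i (q j x) = q j x" if "i < 3" "i \<noteq> j" for i
        using off that by blast+
      from j(1) have "j = 0 \<or> j = 1 \<or> j = 2" by (simp only: less_3_cases)
      then show ?thesis
        unfolding p' using fixed[of 0] fixed[of 1] fixed[of 2] by (elim disjE) simp_all
    qed
    have pairing: "pairing p"
      unfolding pairing_iff
    proof (intro allI impI conjI ballI)
      fix j :: nat assume j: "j < 3"
      fix x assume x: "x \<in> A j"
      show "p x \<in> A j" "p x \<noteq> x" "p (p x) = x"
        using inv[OF j x] on[OF j x] on[OF j inv(1)[OF j x]] by auto
    next
      fix j :: nat assume j: "j < 3"
      show "\<not> (\<exists>a \<in> A j. \<exists>b \<in> A j. \<exists>c \<in> A j. \<exists>d \<in> A j. a < b \<and> b < c \<and> c < d \<and> p a = c \<and> p b = d)"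
        using Q[OF j] on[OF j] unfolding NC2_def by auto
    qed
    have "p x = x" if "x \<notin> M" for x
    proof -
      have "x \<notin> A j" if "j < 3" for j using in_M[OF that] \<open>x \<notin> M\<close> by blast
      then show ?thesis unfolding p' using off by simp
    qed
    with pairing have S: "p \<in> S" by (simp add: S_def)
    define c where "c j = (if j = 0 then c1 else if j = 1 then c2 else c3)" for j :: nat
    have "\<exists>x \<in> A j. c j = {x, p x}" if "j < 3" for j
    proof -
      have "c j \<in> perm_cycles (q j) (A j)"
        using that cs unfolding less_3_cases by (auto simp: c_def q_def)
      then obtain x where x: "x \<in> A j" "c j = orbit (q j) x" unfolding perm_cycles_def by blast
      then show ?thesis using orbit_involution[of "q j" x, OF inv(3)[OF that x(1)]] on[OF that x(1)] by auto
    qed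
    \<comment> \<open>Either point of the cycle \<open>c j\<close> may serve as the chosen
      arc.\<close>
    then obtain d0 where d0: "\<And>j. j < 3 \<Longrightarrow> d0 j \<in> A j \<and> c j = {d0 j, p (d0 j)}" by metis
    define d where "d = (\<lambda>j \<in> {..<3}. d0 j)"
    have pd: "(p, d) \<in> D" using S d0 by (auto simp: D_def d_def)
    have C: "common_edge p d = c1 \<union> c2 \<union> c3"
      unfolding common_edge_eq using d0[of 0] d0[of 1] d0[of 2] by (simp add: d_def c_def)
    have "block_of V x = pblock p d x" if x: "x \<in> M" for x
    proof (cases "x \<in> common_edge p d")
      case True
      then show ?thesis using block_of_eq[OF V CV] C by (simp add: pblock_def)
    next
      case False
      note B = block_of_mem[OF V x]
      then have "block_of V x \<in> perm_cycles p M" using other False C by blast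
      then obtain z where z: "z \<in> M" "block_of V x = orbit p z" unfolding perm_cycles_def by blast
      have pz: "p (p z) = z" using z(1) pairingD(3)[OF pairing] by (blast elim: M_E)
      then have "block_of V x = {z, p z}" using z(2) orbit_involution[of p z] by simp
      \<comment> \<open>The block is a pair \<open>{z, p z}\<close> that contains \<open>x\<close>,
        so \<open>x\<close> is one of its two points.\<close>
      then have "block_of V x = {x, p x}" using B(2) pz by auto
      then show ?thesis using False by (simp add: pblock_def)
    qed
    then have "V = pblock p d ` M" using block_of_image_eq[OF V] by (metis (no_types, lifting) image_cong)
    then show "y \<in> (\<lambda>(p, d). (pblock p d ` M, p)) ` D"
      unfolding Vp by (intro image_eqI[of _ _ "(p, d)"] pd) simp
  qed
qed

lemma card_tree_type: "card {P. partition_on M P \<and> tree_type P} = 4 * card pperms"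
  using card_D_eq_card_tree_type card_D_eq_card_pblock pperms_eq by simp

end

section \<open>The cycles of \<open>gamma\<close>\<close>

text \<open>Mapping a list by its own cycle rotates it by one place, so each entry goes to the next.
  A one-point interval falls under the wrapping case and gives the identity.\<close>

lemma cycle_of_list_upt:
  assumes "x \<in> {a..<b}"
  shows "cycle_of_list [a..<b] x = (if Suc x < b then Suc x else a)"
proof -
  have "map (cycle_of_list [a..<b]) [a..<b] = rotate1 [a..<b]"
    using cyclic_rotation[of "[a..<b]" 1] by simp
  then have "cycle_of_list [a..<b] ([a..<b] ! (x - a)) = rotate1 [a..<b] ! (x - a)"
    using assms by (metis (no_types, lifting) atLeastLessThan_iff diff_less_mono length_upt nth_map)
  also have "\<dots> = [a..<b] ! (Suc (x - a) mod (b - a))" using assms by (subst nth_rotate1) auto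
  finally have *: "cycle_of_list [a..<b] x = [a..<b] ! (Suc (x - a) mod (b - a))"
    using assms by simp
  show ?thesis
  proof (cases "Suc x < b")
    case True
    then show ?thesis using * assms by simp
  next
    case False
    then have "Suc (x - a) = b - a" using assms by auto
    then show ?thesis using * assms False by simp
  qed
qed

theorem lemma8p23:
  fixes m1 m2 m3 :: nat
  shows "card (T26 m1 m2 m3) = 4 * card (PS_NC2_111 m1 m2 m3)"
proof -
  define lo where "lo j = sum_list (take j [m1, m2, m3]) + 1" for j
  define hi where "hi j = sum_list (take (Suc j) [m1, m2, m3]) + 1" for j
  have seg: "seg [m1, m2, m3] j = [lo j..<hi j]" for j by (simp add: seg_def lo_def hi_def)
  have bounds: "lo 0 = 1" "hi 0 = m1 + 1" "lo 1 = m1 + 1" "hi 1 = m1 + m2 + 1"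
    "lo 2 = m1 + m2 + 1" "hi 2 = m1 + m2 + m3 + 1"
    by (simp_all add: lo_def hi_def numeral_eq_Suc)
  let ?c = "\<lambda>j. cycle_of_list [lo j..<hi j]"
  have off: "?c j x = x" if "x \<notin> {lo j..<hi j}" for j x
    using id_outside_supp[of x "[lo j..<hi j]"] that by simp
  have cyc: "?c j x \<in> {lo j..<hi j}" "?c j x = (if Suc x < hi j then Suc x else lo j)"
    if "x \<in> {lo j..<hi j}" for j x
    using cycle_of_list_upt[OF that] that by auto
  have disj: "{lo i..<hi i} \<inter> {lo j..<hi j} = {}" if "i < 3" "j < 3" "i \<noteq> j" for i j
    using that bounds unfolding less_3_cases by auto
  \<comment> \<open>The factors of \<open>gamma\<close> have disjoint supports, so on the interval
    \<open>j\<close> the other two fix both the point and its image.\<close>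
  have on: "gamma m1 m2 m3 x = ?c j x" if "j < 3" "x \<in> {lo j..<hi j}" for j x
  proof -
    have "x \<notin> {lo i..<hi i}" "?c j x \<notin> {lo i..<hi i}" if "i < 3" "i \<noteq> j" for i
      using disj[OF that(1) \<open>j < 3\<close> that(2)] cyc(1) \<open>x \<in> {lo j..<hi j}\<close> by blast+
    then have fixed: "?c i x = x" "?c i (?c j x) = ?c j x" if "i < 3" "i \<noteq> j" for i
      using off that by blast+
    from \<open>j < 3\<close> have "j = 0 \<or> j = 1 \<or> j = 2" by (simp only: less_3_cases)
    then show ?thesis
      unfolding gamma_def seg using fixed[of 0] fixed[of 1] fixed[of 2] by (elim disjE) simp_all
  qed
  interpret three_cycles lo hi "gamma m1 m2 m3"
  proof
    show "gamma m1 m2 m3 i = Suc i" if "j < 3" "lo j \<le> i" "Suc i < hi j" for i j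
      using on[of j i] cyc(2)[of i j] that by simp
    show "gamma m1 m2 m3 i = lo j" if "j < 3" "lo j \<le> i" "Suc i = hi j" for i j
      using on[of j i] cyc(2)[of i j] that by simp
  qed (use disj in blast)
  have A: "set (seg [m1, m2, m3] j) = A j" for j by (simp add: seg A_def)
  have M: "{1..m1 + m2 + m3} = M"
  proof -
    have "{..<3} = {0, 1, 2 :: nat}" by auto
    then have "M = {lo 0..<hi 0} \<union> ({lo 1..<hi 1} \<union> {lo 2..<hi 2})" unfolding M_def A_def by simp
    also have "\<dots> = {1..m1 + m2 + m3}"
      unfolding bounds by (intro set_eqI) (simp only: Un_iff atLeastLessThan_iff atLeastAtMost_iff, arith)
    finally show ?thesis ..
  qed
  have "T26 m1 m2 m3 = {P. partition_on M P \<and> tree_type P}"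
    unfolding T26_def two_six_tree_type_def tree_type_def T_comp_def T_graph_def A M
    by (simp add: quotient_graph_def)
  moreover have "PS_NC2_111 m1 m2 m3 = pperms"
    unfolding PS_NC2_111_def pperms_def A M Let_def ..
  ultimately show ?thesis using card_tree_type by simp
qed

end
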